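(* $\mathrm{SCM}(4,3;4;7,2,6)=\mathrm{RE}$. That is, a language is recursively enumerable if and only if it is generated by an SCM grammar with all of the following properties: - degree $(4,3)$; - at most $4$ nonterminals; - at most $7$ conditional matrices; - all matrices of length at most $2$; - at most $6$ non-simple matrices.
   Context: A semi-conditional matrix (SCM) grammar is a quadruple $G=(V,T,M,S)$ with the following components. - $V$ is a finite alphabet and $T\subsetneq V$ is the set of terminals. - $N=V\setminus T$ is the set of nonterminals and $S\in N$ is the start symbol. - $M$ is a finite set of matrices of the form $r=[(A_1\to x_1),\dots,(A_\ell\to x_\ell),P,F]$, where $\ell\ge 1$, $A_k\in N$, $x_k\in V^*$, and $P,F\in V^+\cup\{\emptyset\}$. Here $\emptyset\notin V$ is a special symbol meaning that the condition is absent, and $|\emptyset|=0$. The number $\ell$ is the length of $r$. A matrix is classified as follows: - unconditional if $P=F=\emptyset$, and conditional otherwise; - simple if at least one of $P,F$ equals $\emptyset$, and non-simple if both $P\neq\emptyset$ and $F\neq\emptyset$. For $x,y\in V^*$ we write $x\Rightarrow_r y$ iff all of the following hold: 1. if $P\neq\emptyset$ then $P$ is a subword (factor) of $x$; 2. if $F\neq\emptyset$ then $F$ is not a subword of $x$; 3. there are words $x=y_0,y_1,\dots,y_\ell=y$ such that $y_k$ is obtained from $y_{k-1}$ by replacing one occurrence of $A_k$ by $x_k$. $\Rightarrow_G$ is the union of the relations $\Rightarrow_r$ over $r\in M$, and $L(G)=\{y\in T^*: S\Rightarrow_G^* y\}$. $G$ has degree $(i,j)$ if every matrix satisfies $|P|\le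 i$ and $|F|\le j$. $\mathrm{SCM}(i,j;n;m,\ell,s)$ denotes the family of languages $L(G)$ of SCM grammars $G$ that satisfy all of the following: - $G$ has degree $(i,j)$; - $|N|\le n$; - $G$ has at most $m$ conditional matrices; - every matrix of $G$ has length at most $\ell$; - $G$ has at most $s$ non-simple matrices. A $*$ in a parameter position means that parameter is unbounded. $\mathrm{SSCM}(i,j;n;m,\ell)=\mathrm{SCM}(i,j;n;m,\ell,0)$, i.e., all matrices are simple. $\mathrm{RE}$ is the class of recursively enumerable languages. *)

theory Defs
  imports Main "HOL-Library.Sublist"
begin

text \<open>Symbols of a grammar over terminal type 't: terminals are Tm a, nonterminals are
  Nt k (nonterminals are labelled by natural numbers; this is no loss of generality since
  every grammar has finitely many nonterminals).\<close>

datatype 't sym = Tm 't | Nt nat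

definition symbols :: "nat set \<Rightarrow> 't set \<Rightarrow> 't sym set" where
  "symbols N T = Tm ` T \<union> Nt ` N"

text \<open>A condition P or F is an option: None stands for the absent condition (the symbol
  \<emptyset> of the paper, of length 0), Some w for a word w.\<close>

record 't matrix =
  rules :: "(nat \<times> 't sym list) list"
  pcond :: "'t sym list option"
  fcond :: "'t sym list option"

record 't scm =
  nts :: "nat set"
  tms :: "'t set"
  start :: nat
  mats :: "'t matrix set"

definition cond_ok :: "'t sym set \<Rightarrow> 't sym list option \<Rightarrow> bool" where
  "cond_ok V c = (case c of None \<Rightarrow> True | Some w \<Rightarrow> w \<noteq> [] \<and> set w \<subseteq> V)"

definition cond_len :: "'t sym list option \<Rightarrow> nat" where
  "cond_len c = (case c of None \<Rightarrow> 0 | Some w \<Rightarrow> length w)"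

definition matrix_ok :: "nat set \<Rightarrow> 't sym set \<Rightarrow> 't matrix \<Rightarrow> bool" where
  "matrix_ok N V r \<longleftrightarrow> rules r \<noteq> [] \<and>
     (\<forall>(A, x) \<in> set (rules r). A \<in> N \<and> set x \<subseteq> V) \<and>
     cond_ok V (pcond r) \<and> cond_ok V (fcond r)"

definition scm_wf :: "'t scm \<Rightarrow> bool" where
  "scm_wf G \<longleftrightarrow> finite (nts G) \<and> finite (tms G) \<and> start G \<in> nts G \<and>
     finite (mats G) \<and>
     (\<forall>r \<in> mats G. matrix_ok (nts G) (symbols (nts G) (tms G)) r)"

definition rewrite1 :: "nat \<Rightarrow> 't sym list \<Rightarrow> 't sym list \<Rightarrow> 't sym list \<Rightarrow> bool" where
  "rewrite1 A x u v \<longleftrightarrow> (\<exists>p q. u = p @ [Nt A] @ q \<and> v = p @ x @ q)"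

fun rewrite_seq :: "(nat \<times> 't sym list) list \<Rightarrow> 't sym list \<Rightarrow> 't sym list \<Rightarrow> bool" where
  "rewrite_seq [] u v \<longleftrightarrow> u = v"
| "rewrite_seq ((A, x) # rs) u v \<longleftrightarrow> (\<exists>w. rewrite1 A x u w \<and> rewrite_seq rs w v)"

definition mstep :: "'t matrix \<Rightarrow> 't sym list \<Rightarrow> 't sym list \<Rightarrow> bool" where
  "mstep r x y \<longleftrightarrow>
     (case pcond r of None \<Rightarrow> True | Some P \<Rightarrow> sublist P x) \<and>
     (case fcond r of None \<Rightarrow> True | Some F \<Rightarrow> \<not> sublist F x) \<and>
     rewrite_seq (rules r) x y"

definition scm_step :: "'t scm \<Rightarrow> 't sym list \<Rightarrow> 't sym list \<Rightarrow> bool" where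
  "scm_step G x y \<longleftrightarrow> (\<exists>r \<in> mats G. mstep r x y)"

definition scm_lang :: "'t scm \<Rightarrow> 't list set" where
  "scm_lang G = {w. set w \<subseteq> tms G \<and> (scm_step G)\<^sup>*\<^sup>* [Nt (start G)] (map Tm w)}"

definition conditional :: "'t matrix \<Rightarrow> bool" where
  "conditional r \<longleftrightarrow> pcond r \<noteq> None \<or> fcond r \<noteq> None"

definition non_simple :: "'t matrix \<Rightarrow> bool" where
  "non_simple r \<longleftrightarrow> pcond r \<noteq> None \<and> fcond r \<noteq> None"

definition SCM :: "nat \<Rightarrow> nat \<Rightarrow> nat \<Rightarrow> nat \<Rightarrow> nat \<Rightarrow> nat \<Rightarrow> 't list set set" where
  "SCM i j n m l s = {L. \<exists>G :: 't scm. scm_wf G \<and> L = scm_lang G \<and>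
     (\<forall>r \<in> mats G. cond_len (pcond r) \<le> i \<and> cond_len (fcond r) \<le> j) \<and>
     card (nts G) \<le> n \<and>
     card {r \<in> mats G. conditional r} \<le> m \<and>
     (\<forall>r \<in> mats G. length (rules r) \<le> l) \<and>
     card {r \<in> mats G. non_simple r} \<le> s}"

record 't ugram =
  unts :: "nat set"
  utms :: "'t set"
  ustart :: nat
  prods :: "('t sym list \<times> 't sym list) set"

definition ugram_wf :: "'t ugram \<Rightarrow> bool" where
  "ugram_wf G \<longleftrightarrow> finite (unts G) \<and> finite (utms G) \<and> ustart G \<in> unts G \<and>
     finite (prods G) \<and>
     (\<forall>(\<alpha>, \<beta>) \<in> prods G. set \<alpha> \<subseteq> symbols (unts G) (utms G) \<and>
        set \<beta> \<subseteq> symbols (unts G) (utms G) \<and> (\<exists>A \<in> unts G. Nt A \<in> set \<alpha>))"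

definition ustep :: "'t ugram \<Rightarrow> 't sym list \<Rightarrow> 't sym list \<Rightarrow> bool" where
  "ustep G x y \<longleftrightarrow> (\<exists>(\<alpha>, \<beta>) \<in> prods G. \<exists>p q. x = p @ \<alpha> @ q \<and> y = p @ \<beta> @ q)"

definition ugram_lang :: "'t ugram \<Rightarrow> 't list set" where
  "ugram_lang G = {w. set w \<subseteq> utms G \<and> (ustep G)\<^sup>*\<^sup>* [Nt (ustart G)] (map Tm w)}"

definition RE :: "'t list set set" where
  "RE = {L. \<exists>G :: 't ugram. ugram_wf G \<and> L = ugram_lang G}"

end

theory Submission
  imports Defs
begin

text \<open>
  Every recursively enumerable language has a representation in the style of Post's correspondence
  problem: \<open>w\<close> belongs to the language iff some sequence of pairs \<open>(u, v)\<close> from a fixed finite set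
  satisfies \<open>w\<^sup>R # u\<^sub>1 \<dots> u\<^sub>k = v\<^sub>1 \<dots> v\<^sub>k S #\<close>. The two sides spell out a derivation of \<open>w\<close> backwards,
  one of them lagging behind by one sentential form. An SCM grammar first emits both sides
  around its generating nonterminal \<open>NG\<close> by unconditional matrices, the right-hand side mirrored and
  with the symbol \<open>c\<close> coded by the word of \<open>c + 1\<close> letters \<open>NA\<close> followed by \<open>NB\<close>. Then the two codes
  are compared outwards from the centre. The centre is the only place where two \<open>NB\<close> are adjacent,
  so that permitting words can recognise it: the two letters next to it are
  guessed by turning two equal letters into \<open>NX\<close>, and the marks can be erased only if they sit at
  the centre.

  Conversely, an unrestricted grammar simulates an SCM grammar by a head that scans the
  sentential form.
\<close>

section \<open>Rewriting with marks\<close>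

text \<open>A rule may rewrite any occurrence of its nonterminal; only the permitting and forbidding
  words restrict where. Equality of the two letters at the centre is therefore tested by the
  permitting word of the marking matrix (\<open>NA NB NB NA\<close> or \<open>NB NB NB NB\<close>),
  not by the rewriting. Forbidding \<open>NX\<close> there leaves exactly two marks, so undoing the
  marks recovers the tested word and locates them. Two adjacent marked \<open>NA\<close> inside a
  code block can also yield \<open>NB NX NX NB\<close> away from the centre; forbidding
  \<open>NB NB\<close> excludes this, because marking \<open>NA\<close> leaves the central pair
  intact. Four nonterminals suffice because \<open>NX\<close> has two jobs: growth point to the
  right of \<open>NG\<close>, later the mark. The phases do not interfere: every cancelling matrix
  requires two adjacent \<open>NB\<close> or two adjacent \<open>NX\<close>, neither of which exists
  before \<open>end_mat\<close>, and every emitting matrix rewrites \<open>NG\<close>, which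
  \<open>end_mat\<close> removes. The number of terminals and pairs depends on the language, so
  their matrices are unconditional; the seven conditional ones are the five of
  \<open>cancel_mats\<close>, \<open>switch_mat\<close> and \<open>end_mat\<close>.\<close>

abbreviation "NG \<equiv> Nt 0"
abbreviation "NA \<equiv> Nt (Suc 0)"
abbreviation "NB \<equiv> Nt 2"
abbreviation "NX \<equiv> Nt 3"

text \<open>Applied to \<open>NG\<close> and \<open>NX\<close> in the emitting phases, where each
  occurs at most once and a rule for it is therefore deterministic.\<close>

lemma rewrite1_unique:
  assumes "rewrite1 k x (p @ Nt k # q) y" "Nt k \<notin> set p" "Nt k \<notin> set q"
  shows "y = p @ x @ q"
proof -
  from assms(1) obtain p' q' where e: "p @ Nt k # q = p' @ Nt k # q'" and y: "y = p' @ x @ q'"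
    by (auto simp: rewrite1_def)
  have "Nt k \<notin> set p'"
  proof
    assume "Nt k \<in> set p'"
    hence "count_list (p' @ Nt k # q') (Nt k) \<ge> 2"
      by (auto simp: Suc_le_eq count_list_0_iff intro!: gr0I)
    moreover have "count_list (p @ Nt k # q) (Nt k) = 1"
      using assms(2,3) by (simp add: count_list_0_iff)
    ultimately show False using e by simp
  qed
  hence "p = p' \<and> q = q'"
    using e assms(2) by (metis append_Cons_eq_iff assms(3) append_eq_Cons_conv split_list_first)
  thus ?thesis using y by simp
qed

lemma rewrite1_mem: "rewrite1 k x u v \<Longrightarrow> Nt k \<in> set u"
  by (auto simp: rewrite1_def)

lemma rewrite1I: "rewrite1 k x (p @ Nt k # q) (p @ x @ q)"
  by (auto simp: rewrite1_def)

lemma rewrite1_erase: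
  assumes "rewrite1 k [] u v"
  shows "filter (\<lambda>c. c \<noteq> Nt k) v = filter (\<lambda>c. c \<noteq> Nt k) u"
    and "count_list u (Nt k) = Suc (count_list v (Nt k))"
  using assms by (auto simp: rewrite1_def)

text \<open>With exactly two copies present, the choice of occurrences does not matter and erasing
  becomes a filter.\<close>

lemma rewrite_seq_erase2:
  assumes "rewrite_seq [(k, []), (k, [])] u v" "count_list u (Nt k) = 2"
  shows "v = filter (\<lambda>c. c \<noteq> Nt k) u"
proof -
  from assms(1) obtain w where w: "rewrite1 k [] u w" "rewrite1 k [] w v" by auto
  have "count_list v (Nt k) = 0" using w[THEN rewrite1_erase(2)] assms(2) by simp
  hence "filter (\<lambda>c. c \<noteq> Nt k) v = v" by (auto simp: count_list_0_iff filter_id_conv)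
  thus ?thesis using w[THEN rewrite1_erase(1)] by simp
qed

text \<open>\<open>b\<close> is the letter from which the marks were made. Both marks come from the
  same letter, so they can be undone without knowing where they are.\<close>

definition unmark :: "'t sym \<Rightarrow> 't sym \<Rightarrow> 't sym" where
  "unmark b c = (if c = NX then b else c)"

lemma rewrite1_mark:
  assumes "rewrite1 k [NX] u v" "k \<noteq> 3"
  shows "map (unmark (Nt k)) v = map (unmark (Nt k)) u" "count_list v NX = Suc (count_list u NX)"
    "count_list u (Nt k) = Suc (count_list v (Nt k))"
  using assms by (auto simp: rewrite1_def unmark_def)

lemma map_unmark_id: "NX \<notin> set u \<Longrightarrow> map (unmark b) u = u"
  by (induction u) (auto simp: unmark_def)

lemma rewrite_seq_mark2:
  assumes "rewrite_seq [(k, [NX]), (k, [NX])] u v" "k \<noteq> 3" "NX \<notin> set u"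
  shows "map (unmark (Nt k)) v = u" "count_list v NX = 2"
    "count_list u (Nt k) = count_list v (Nt k) + 2"
proof -
  from assms(1) obtain w where w: "rewrite1 k [NX] u w" "rewrite1 k [NX] w v" by auto
  note r = rewrite1_mark[OF w(1) assms(2)] rewrite1_mark[OF w(2) assms(2)]
  show "map (unmark (Nt k)) v = u" using r(1,4) map_unmark_id[OF assms(3)] by simp
  show "count_list v NX = 2" using r(2,5) assms(3) by (simp add: count_list_0_iff)
  show "count_list u (Nt k) = count_list v (Nt k) + 2" using r by simp
qed

section \<open>Factors that consist of a doubled letter, and the centre\<close>

lemma sublist_double_sep:
  "c \<noteq> b \<Longrightarrow> sublist [b, b] (xs @ c # ys) \<longleftrightarrow> sublist [b, b] xs \<or> sublist [b, b] ys"
proof (induction xs)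
  case Nil
  thus ?case by (auto simp: sublist_Cons_right)
next
  case (Cons x xs)
  thus ?case by (cases xs) (auto simp: sublist_Cons_right)
qed

lemma sublist_double_notin: "b \<notin> set xs \<Longrightarrow> \<not> sublist [b, b] xs"
  using set_mono_sublist by fastforce

lemma sublist_double_rev: "sublist [b, b] (rev xs) = sublist [b, b] xs"
  using sublist_rev[of "[b,b]" xs] by simp

lemma sublist_double_append_notin:
  "b \<notin> set ys \<Longrightarrow> sublist [b, b] (xs @ ys) = sublist [b, b] xs"
  by (cases ys) (auto simp: sublist_double_sep sublist_double_notin)

lemma sublist_double_mid: "sublist [b,b] (xs @ b # b # ys)"
  by (metis append_Cons append_Nil sublist_appendI)

text \<open>Keeps of a code what survives the loss of its last letter, since cancellation cuts
  through code blocks. The leading \<open>NA\<close> makes absence of \<open>NA\<close> equivalent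
  to emptiness, which is what the finishing matrix tests.\<close>

definition mirrorable :: "'t sym list \<Rightarrow> bool" where
  "mirrorable l \<longleftrightarrow> set l \<subseteq> {NA, NB} \<and> \<not> sublist [NB, NB] l \<and> (l = [] \<or> hd l = NA)"

lemma mirrorable_butlast: "mirrorable (l @ [c]) \<Longrightarrow> mirrorable l"
  unfolding mirrorable_def
  by (cases l) (auto dest: sublist_order.order.trans[OF _ sublist_append_rightI] simp del: sublist_Cons_right)

text \<open>An occurrence shifted by one from the centre would put an \<open>NA\<close> on a central
  \<open>NB\<close>; shifted further, its \<open>NB NB\<close> would lie inside \<open>l\<close> or
  \<open>r\<close>.\<close>

lemma center_ABBA:
  assumes e: "p @ [NA, NB, NB, NA] @ q = l @ [NB, NB] @ r"
    and l: "\<not> sublist [NB, NB] l" and r: "\<not> sublist [NB, NB] r"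
  shows "l = p @ [NA] \<and> r = NA # q"
  using e unfolding append_eq_append_conv2[of p]
proof (elim exE disjE conjE)
  fix us assume a: "p = l @ us" "us @ [NA, NB, NB, NA] @ q = [NB, NB] @ r"
  thus ?thesis using r sublist_double_mid[of NB "tl (tl us) @ [NA]"]
    by (cases us; cases "tl us") auto
next
  fix us assume a: "p @ us = l" "[NA, NB, NB, NA] @ q = us @ [NB, NB] @ r"
  thus ?thesis using l sublist_double_mid[of NB "p @ [NA]" "drop 3 us"]
    by (cases us; cases "tl us"; cases "tl (tl us)") auto
qed

text \<open>Here \<open>NB NB\<close> occurs several times, but four \<open>NB\<close> shifted from
  the symmetric position have their first two letters inside \<open>l\<close> or their last two
  inside \<open>r\<close>.\<close>

lemma center_BBBB:
  assumes e: "p @ [NB, NB, NB, NB] @ q = l @ [NB, NB] @ r"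
    and l: "\<not> sublist [NB, NB] l" and r: "\<not> sublist [NB, NB] r"
  shows "l = p @ [NB] \<and> r = NB # q"
  using e unfolding append_eq_append_conv2[of p]
proof (elim exE disjE conjE)
  fix us assume a: "p = l @ us" "us @ [NB, NB, NB, NB] @ q = [NB, NB] @ r"
  thus ?thesis using r sublist_double_mid[of NB "tl (tl us)"] sublist_double_mid[of NB "[]"]
    by (cases us; cases "tl us") auto
next
  fix us assume a: "p @ us = l" "[NB, NB, NB, NB] @ q = us @ [NB, NB] @ r"
  thus ?thesis using l r sublist_double_mid[of NB] sublist_double_mid[of NB "[]"]
    by (cases us; cases "tl us"; cases "tl (tl us)") auto
qed

text \<open>\<open>Suc c\<close> letters instead of \<open>c\<close>: an empty block would put two
  \<open>NB\<close> next to each other and imitate the centre.\<close>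

fun codeL :: "nat list \<Rightarrow> 't sym list" where
  "codeL [] = []"
| "codeL (c # cs) = replicate (Suc c) NA @ NB # codeL cs"

lemma codeL_append [simp]: "codeL (xs @ ys) = codeL xs @ codeL ys"
  by (induction xs) auto

lemma set_codeL: "set (codeL xs) \<subseteq> {NA, NB}"
  by (induction xs) auto

lemma replicate_Cons_inj:
  "a \<noteq> b \<Longrightarrow> replicate m a @ b # xs = replicate n a @ b # ys \<Longrightarrow> m = n \<and> xs = ys"
proof (induction m arbitrary: n)
  case 0
  thus ?case by (cases n) auto
next
  case (Suc m)
  thus ?case by (cases n) auto
qed

lemma codeL_inj: "codeL xs = codeL ys \<Longrightarrow> xs = ys"
proof (induction xs arbitrary: ys)
  case Nil
  thus ?case by (cases ys) auto
next
  case (Cons x xs)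
  thus ?case by (cases ys) (auto dest!: replicate_Cons_inj[rotated])
qed

lemma hd_codeL: "(codeL xs :: 't sym list) = [] \<or> hd (codeL xs :: 't sym list) = NA"
  by (cases xs) auto

lemma mirrorable_codeL: "mirrorable (codeL xs)"
proof -
  have "\<not> sublist [NB, NB] (codeL xs :: 'a sym list)"
  proof (induction xs)
    case (Cons x xs)
    have "sublist [NB, NB] (replicate x NA @ NA # NB # codeL xs :: 'a sym list) \<longleftrightarrow>
       sublist [NB, NB] (NB # codeL xs :: 'a sym list)"
      by (subst sublist_double_sep) (auto simp: sublist_double_notin)
    moreover have "\<not> sublist [NB, NB] (NB # codeL xs :: 'a sym list)"
      using Cons hd_codeL[of xs, where ?'t = 'a]
      by (cases "codeL xs :: 'a sym list") (auto simp: sublist_Cons_right)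
    moreover have "codeL (x # xs) = (replicate x NA @ NA # NB # codeL xs :: 'a sym list)"
      by (simp add: replicate_app_Cons_same)
    ultimately show ?case by metis
  qed auto
  thus ?thesis using set_codeL hd_codeL unfolding mirrorable_def by blast
qed

section \<open>Cancelling mirrored words\<close>

lemma sublist_singleton: "sublist [c] xs \<longleftrightarrow> c \<in> set xs"
  by (metis append_Cons append_Nil in_set_conv_decomp sublist_def)

abbreviation mat :: "(nat \<times> 't sym list) list \<Rightarrow> 't sym list option \<Rightarrow> 't sym list option \<Rightarrow> 't matrix" where
  "mat rs p f \<equiv> \<lparr>rules = rs, pcond = p, fcond = f\<rparr>"

text \<open>Marks made from \<open>NA\<close> flank the central \<open>NB NB\<close>; of four
  central \<open>NB\<close> the inner two can be marked, which is the case of the fourth matrix. The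
  last matrix tests through the forbidden \<open>NA\<close> that both codes are used up.\<close>

definition cancel_mats :: "'t matrix set" where
  "cancel_mats = {
     mat [(1, [NX]), (1, [NX])] (Some [NA, NB, NB, NA]) (Some [NX]),
     mat [(2, [NX]), (2, [NX])] (Some [NB, NB, NB, NB]) (Some [NX]),
     mat [(3, []), (3, [])] (Some [NX, NB, NB, NX]) None,
     mat [(3, []), (3, [])] (Some [NB, NX, NX, NB]) (Some [NB, NB]),
     mat [(2, []), (2, [])] (Some [NB, NB]) (Some [NA])}"

lemma cancel_matsE:
  assumes "r \<in> cancel_mats" "mstep r x y"
  obtains
    (markA) "sublist [NA, NB, NB, NA] x" "NX \<notin> set x" "rewrite_seq [(1, [NX]), (1, [NX])] x y"
  | (markB) "sublist [NB, NB, NB, NB] x" "NX \<notin> set x" "rewrite_seq [(2, [NX]), (2, [NX])] x y"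
  | (delA) "sublist [NX, NB, NB, NX] x" "rewrite_seq [(3, []), (3, [])] x y"
  | (delB) "sublist [NB, NX, NX, NB] x" "\<not> sublist [NB, NB] x" "rewrite_seq [(3, []), (3, [])] x y"
  | (finish) "sublist [NB, NB] x" "NA \<notin> set x" "rewrite_seq [(2, []), (2, [])] x y"
  using assms unfolding cancel_mats_def mstep_def sublist_singleton[symmetric]
  by (auto simp del: rewrite_seq.simps)

text \<open>The invariant of the cancellation phase: \<open>l0\<close> and \<open>r0\<close> are the words initially to be compared,
  \<open>s\<close> is the common suffix cancelled so far. The second disjunct is the state between marking
  and erasing; the last one is a dead end, reached when the two central \<open>NB\<close> are erased too early.\<close>

definition cancelling :: "'t list \<Rightarrow> 't sym list \<Rightarrow> 't sym list \<Rightarrow> 't sym list \<Rightarrow> bool" where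
  "cancelling w l0 r0 x \<longleftrightarrow>
     (\<exists>l r s. x = l @ [NB, NB] @ rev r @ map Tm w \<and> mirrorable l \<and> mirrorable r \<and>
        l0 = l @ s \<and> r0 = r @ s) \<or>
     (\<exists>l r s. \<exists>k \<in> {1, 2}. mirrorable (l @ [Nt k]) \<and> mirrorable (r @ [Nt k]) \<and>
        l0 = l @ Nt k # s \<and> r0 = r @ Nt k # s \<and>
        rewrite_seq [(k, [NX]), (k, [NX])] (l @ [Nt k, NB, NB, Nt k] @ rev r @ map Tm w) x) \<or>
     (x = map Tm w \<and> l0 = r0) \<or>
     (NX \<in> set x \<and> NB \<notin> set x \<and> NG \<notin> set x)"

lemma mirrorable_right:
  assumes "mirrorable r"
  shows "\<not> sublist [NB, NB] (rev r @ map Tm w)" 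
  using assms unfolding mirrorable_def
  by (subst sublist_double_append_notin) (auto simp: sublist_double_rev)

lemma mirrorable_right_Cons:
  assumes "rev r @ map Tm w = Nt k # q"
  obtains r' where "r = r' @ [Nt k]" "q = rev r' @ map Tm w"
  using assms by (cases r rule: rev_cases) auto

text \<open>Without \<open>NX\<close> no mark can be erased. A marking matrix forces equal last
  letters of \<open>l\<close> and \<open>r\<close> by the lemmas on the centre; finishing forces
  both words to be empty, so that only the common suffix \<open>s\<close> remains on either
  side.\<close>

lemma cancel_step_unmarked:
  assumes ml: "mirrorable l" and mr: "mirrorable r"
    and m: "m \<in> cancel_mats" "mstep m (l @ [NB, NB] @ rev r @ map Tm w) y"
  shows "cancelling w (l @ s) (r @ s) y"
proof -
  let ?x = "l @ [NB, NB] @ rev r @ map Tm w"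
  have l: "\<not> sublist [NB, NB] l" using ml by (simp add: mirrorable_def)
  have r: "\<not> sublist [NB, NB] (rev r @ map Tm w)" by (rule mirrorable_right[OF mr])
  have nX: "NX \<notin> set ?x" using ml mr by (auto simp: mirrorable_def)
  have marked: "cancelling w (l @ s) (r @ s) y"
    if k: "k \<in> {1, 2}" and x: "l = p @ [Nt k]" "rev r @ map Tm w = Nt k # q"
      and rw: "rewrite_seq [(k, [NX]), (k, [NX])] ?x y" for k p q
  proof -
    obtain r' where r': "r = r' @ [Nt k]" "q = rev r' @ map Tm w"
      using mirrorable_right_Cons[OF x(2)] .
    have "mirrorable (p @ [Nt k]) \<and> mirrorable (r' @ [Nt k]) \<and> l @ s = p @ Nt k # s \<and>
        r @ s = r' @ Nt k # s \<and>
        rewrite_seq [(k, [NX]), (k, [NX])] (p @ [Nt k, NB, NB, Nt k] @ rev r' @ map Tm w) y"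
      using ml mr x(1) r' rw by (simp del: rewrite_seq.simps)
    thus ?thesis using k unfolding cancelling_def by blast
  qed
  from m show ?thesis
  proof (cases rule: cancel_matsE)
    case markA
    then obtain p q where "?x = p @ [NA, NB, NB, NA] @ q" by (auto simp: sublist_def)
    with center_ABBA[OF _ l r] have "l = p @ [NA]" "rev r @ map Tm w = NA # q" by metis+
    thus ?thesis using marked[of 1 p q] markA(3) by (simp del: rewrite_seq.simps)
  next
    case markB
    then obtain p q where "?x = p @ [NB, NB, NB, NB] @ q" by (auto simp: sublist_def)
    with center_BBBB[OF _ l r] have "l = p @ [NB]" "rev r @ map Tm w = NB # q" by metis+
    thus ?thesis using marked[of 2 p q] markB(3) by (simp del: rewrite_seq.simps)
  next
    case delA
    thus ?thesis using nX set_mono_sublist by fastforce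
  next
    case delB
    thus ?thesis using nX set_mono_sublist by fastforce
  next
    case finish
    have "l = []" "r = []"
      using finish(2) ml mr unfolding mirrorable_def by (cases l; cases r; auto)+
    moreover have "y = filter (\<lambda>c. c \<noteq> NB) ?x"
      by (rule rewrite_seq_erase2[OF finish(3)])
        (use calculation in \<open>auto simp: count_list_0_iff\<close>)
    ultimately show ?thesis unfolding cancelling_def by (auto simp: filter_id_conv)
  qed
qed

lemma count_unmark: "c \<noteq> b \<Longrightarrow> c \<noteq> NX \<Longrightarrow> count_list (map (unmark b) y) c = count_list y c"
  by (induction y) (auto simp: unmark_def)

lemma set_unmark: "c \<noteq> b \<Longrightarrow> c \<noteq> NX \<Longrightarrow> c \<in> set (map (unmark b) y) \<longleftrightarrow> c \<in> set y"
  by (induction y) (auto simp: unmark_def)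

lemma unmark_eq_iff: "b \<noteq> c \<Longrightarrow> c \<noteq> NX \<Longrightarrow> unmark b d = c \<longleftrightarrow> d = c"
  by (auto simp: unmark_def)

text \<open>Undoing the marks turns the permitting word of a legitimate erasure into
  \<open>NA NB NB NA\<close> or \<open>NB NB NB NB\<close>, whose position is known. So the marks
  are the two tested letters, and erasing them moves one letter to the common suffix. Finishing at
  this point leads to the dead end.\<close>

lemma cancel_step_marked:
  assumes k: "k \<in> {1, 2}" and ml: "mirrorable (l @ [Nt k])" and mr: "mirrorable (r @ [Nt k])"
    and rw: "rewrite_seq [(k, [NX]), (k, [NX])] (l @ [Nt k, NB, NB, Nt k] @ rev r @ map Tm w) x"
    and m: "m \<in> cancel_mats" "mstep m x y"
  shows "cancelling w (l @ Nt k # s) (r @ Nt k # s) y"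
proof -
  let ?o = "l @ [Nt k, NB, NB, Nt k] @ rev r @ map Tm w"
  have l: "\<not> sublist [NB, NB] (l @ [Nt k])" using ml by (simp add: mirrorable_def)
  have r: "\<not> sublist [NB, NB] (Nt k # rev r @ map Tm w)" using mirrorable_right[OF mr, of w] by simp
  have ml': "mirrorable l" and mr': "mirrorable r" using ml mr by (auto intro: mirrorable_butlast)
  have k3: "k \<noteq> 3" and nX: "NX \<notin> set ?o" using k ml mr by (auto simp: mirrorable_def)
  note mk = rewrite_seq_mark2[OF rw k3 nX]
  have X: "NX \<in> set x" using mk(2) by (metis count_notin zero_neq_numeral)
  have "NG \<notin> set ?o" using k ml mr by (auto simp: mirrorable_def)
  hence G: "NG \<notin> set x" using k set_unmark[of NG "Nt k" x] unfolding mk(1) by auto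
  have deleted: "cancelling w (l @ Nt k # s) (r @ Nt k # s) y"
    if x: "x = p @ c @ q" and c: "map (unmark (Nt k)) c = [Nt k, NB, NB, Nt k]"
      "filter (\<lambda>c. c \<noteq> NX) c = [NB, NB]" "count_list c NX = 2"
      and del: "rewrite_seq [(3, []), (3, [])] x y" for p q c
  proof -
    have pq: "NX \<notin> set p" "NX \<notin> set q" using mk(2) c(3) unfolding x by (auto simp: count_list_0_iff)
    have "p @ [Nt k, NB, NB, Nt k] @ q = (l @ [Nt k]) @ [NB, NB] @ Nt k # rev r @ map Tm w"
      using mk(1) c(1) pq by (simp add: x map_unmark_id)
    hence e: "p = l \<and> q = rev r @ map Tm w"
      using k center_ABBA[OF _ l r, of p q] center_BBBB[OF _ l r, of p q] by auto
    have "filter (\<lambda>c. c \<noteq> NX) p = p" "filter (\<lambda>c. c \<noteq> NX) q = q"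
      using pq by (auto simp: filter_id_conv)
    hence "y = p @ [NB, NB] @ q" using rewrite_seq_erase2[OF del mk(2)] c(2) by (simp add: x)
    thus ?thesis using e ml' mr' unfolding cancelling_def by blast
  qed
  from m show ?thesis
  proof (cases rule: cancel_matsE)
    case markA
    thus ?thesis using X by simp
  next
    case markB
    thus ?thesis using X by simp
  next
    case delA
    then obtain p q where "x = p @ [NX, NB, NB, NX] @ q" by (auto simp: sublist_def)
    thus ?thesis by (rule deleted) (use k delA in \<open>auto simp: unmark_def\<close>)
  next
    case delB
    then obtain p q where x: "x = p @ [NB, NX, NX, NB] @ q" by (auto simp: sublist_def)
    \<comment> \<open>For marks made from \<open>NA\<close>, \<open>unmark NA\<close> reflects
      \<open>NB\<close>, so the central pair is still present in \<open>x\<close>.\<close>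
    have "k = 2"
    proof (rule ccontr)
      assume "k \<noteq> 2"
      hence k1: "k = 1" using k by simp
      have "map (unmark NA) x = (l @ [NA]) @ NB # NB # NA # rev r @ map Tm w"
        using mk(1) k1 by simp
      from map_eq_append_conv[THEN iffD1, OF this] obtain a b where ab: "x = a @ b"
        "map (unmark NA) b = NB # NB # NA # rev r @ map Tm w" by metis
      obtain c b' where b': "b = c # b'" "unmark NA c = NB"
        "map (unmark NA) b' = NB # NA # rev r @ map Tm w"
        using ab(2) by (cases b) auto
      obtain d e where "b' = d # e" "unmark NA d = NB"
        using b'(3) by (cases b') auto
      hence "x = a @ NB # NB # e" using ab(1) b' by (simp add: unmark_eq_iff)
      thus False using delB(2) by (simp add: sublist_double_mid)
    qed
    with x show ?thesis by (intro deleted[of p _ q]) (use delB in \<open>auto simp: unmark_def\<close>)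
  next
    case finish
    have k1: "k = 1"
    proof (rule ccontr)
      assume "k \<noteq> 1"
      hence k2: "k = 2" using k by simp
      \<comment> \<open>\<open>l @ [NB]\<close> starts with \<open>NA\<close>, so \<open>l\<close>
        contains an \<open>NA\<close>, which marking \<open>NB\<close> leaves alone and the
        forbidding word rejects.\<close>
      hence "NA \<in> set l" using ml by (cases l) (auto simp: mirrorable_def)
      hence "NA \<in> set (map (unmark (Nt k)) x)" by (simp add: mk(1))
      thus False using finish(2) k2 by (subst (asm) set_unmark) auto
    qed
    \<comment> \<open>No unmarked \<open>NA\<close> is left, so there were just two before marking,
      and these flank the centre.\<close>
    have "count_list ?o NA = 2" using mk(3) finish(2) k1 by (simp add: count_list_0_iff)
    hence "NA \<notin> set l" "NA \<notin> set r" using k1 by (auto simp: count_list_0_iff)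
    hence lr: "l = []" "r = []" using ml' mr' unfolding mirrorable_def by (cases l; cases r; auto)+
    have "count_list x NB = count_list ?o NB" using count_unmark[of NB NA x] mk(1) k1 by simp
    hence "count_list x NB = 2" using lr k1 by (auto simp: count_list_0_iff)
    hence "y = filter (\<lambda>c. c \<noteq> NB) x" by (rule rewrite_seq_erase2[OF finish(3)])
    thus ?thesis using X G unfolding cancelling_def by auto
  qed
qed

lemma cancelling_step:
  assumes c: "cancelling w l0 r0 x" and m: "m \<in> cancel_mats" "mstep m x y"
  shows "cancelling w l0 r0 y"
proof -
  \<comment> \<open>Every permitting word contains \<open>NB\<close>; hence neither the finished
    word nor the dead end admits a step.\<close>
  have B: "NB \<in> set x" using m
    by (cases rule: cancel_matsE) (auto dest!: set_mono_sublist simp del: rewrite_seq.simps)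
  show ?thesis
    using c unfolding cancelling_def[of w l0 r0 x]
  proof (elim disjE exE conjE bexE)
    fix l r s
    assume "x = l @ [NB, NB] @ rev r @ map Tm w" "mirrorable l" "mirrorable r"
      "l0 = l @ s" "r0 = r @ s"
    thus ?thesis using cancel_step_unmarked m by blast
  next
    fix l r s k
    assume "k \<in> {1, 2}" "mirrorable (l @ [Nt k])" "mirrorable (r @ [Nt k])"
      "l0 = l @ Nt k # s" "r0 = r @ Nt k # s"
      "rewrite_seq [(k, [NX]), (k, [NX])] (l @ [Nt k, NB, NB, Nt k] @ rev r @ map Tm w) x"
    thus ?thesis using cancel_step_marked m by blast
  qed (use B in auto)
qed

lemma rewrite_seq_mark2_set:
  assumes "rewrite_seq [(k, [NX]), (k, [NX])] u x"
  shows "set x \<subseteq> insert NX (set u)" "NX \<in> set x"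
proof -
  from assms obtain v where "rewrite1 k [NX] u v" "rewrite1 k [NX] v x" by auto
  moreover have "set b \<subseteq> insert NX (set a) \<and> NX \<in> set b" if "rewrite1 k [NX] a b"
    for a b :: "'a sym list"
    using that by (auto simp: rewrite1_def)
  ultimately show "set x \<subseteq> insert NX (set u)" "NX \<in> set x" by blast+
qed

lemma cancelling_NG:
  assumes "cancelling w l0 r0 x"
  shows "NG \<notin> set x"
  using assms unfolding cancelling_def
proof (elim disjE exE conjE bexE)
  fix l r s k
  assume a: "k \<in> {1, 2}" "mirrorable (l @ [Nt k])" "mirrorable (r @ [Nt k])"
    "rewrite_seq [(k, [NX]), (k, [NX])] (l @ [Nt k, NB, NB, Nt k] @ rev r @ map Tm w) x"
  have "NG \<notin> set (l @ [Nt k, NB, NB, Nt k] @ rev r @ map Tm w)"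
    using a(1-3) by (auto simp: mirrorable_def)
  thus ?thesis using rewrite_seq_mark2_set(1)[OF a(4)] by auto
qed (auto simp: mirrorable_def)

lemma cancelling_final:
  assumes "cancelling w l0 r0 (map Tm v)"
  shows "v = w \<and> l0 = r0"
  using assms unfolding cancelling_def
proof (elim disjE exE conjE bexE)
  fix l r s
  assume "map Tm v = l @ [NB, NB] @ rev r @ map Tm w"
  from arg_cong[OF this, of set] show ?thesis by auto
next
  fix l r s k
  assume "rewrite_seq [(k, [NX]), (k, [NX])] (l @ [Nt k, NB, NB, Nt k] @ rev r @ map Tm w) (map Tm v)"
  from rewrite_seq_mark2_set(2)[OF this] show ?thesis by auto
next
  assume "map Tm v = map Tm w" "l0 = r0"
  thus ?thesis using map_injective[of Tm v w] by (auto simp: inj_def)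
qed auto

section \<open>Completeness of the cancellation\<close>

lemma cancel_step_match:
  fixes w :: "'t list"
  assumes c: "c \<in> {NA, NB}" and m: "mirrorable (l @ [c])"
  defines "x \<equiv> \<lambda>u. l @ u @ rev l @ map Tm w"
  shows "\<exists>m1 \<in> cancel_mats. \<exists>m2 \<in> cancel_mats. \<exists>y.
    mstep m1 (x [c, NB, NB, c]) y \<and> mstep m2 y (x [NB, NB])"
proof -
  have sl: "sublist u (x u)" for u by (simp add: x_def)
  have nX: "NX \<notin> set (x [c, NB, NB, c])" using c m by (auto simp: mirrorable_def x_def)
  have rw: "rewrite_seq [(k, v), (k, v)] (p @ Nt k # q @ Nt k # t) (p @ v @ q @ v @ t)" for k v p q t
    using rewrite1I[of k v p "q @ Nt k # t"] rewrite1I[of k v "p @ v @ q" t] by auto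
  show ?thesis
  proof (cases "c = NA")
    case True
    have "mstep (mat [(1, [NX]), (1, [NX])] (Some [NA, NB, NB, NA]) (Some [NX]))
      (x [c, NB, NB, c]) (x [NX, NB, NB, NX])"
      using nX rw[of 1 "[NX]" l "[NB, NB]" "rev l @ map Tm w"]
      sl[of "[NA, NB, NB, NA]"]
      by (simp add: mstep_def True x_def sublist_singleton del: rewrite_seq.simps)
    moreover have "mstep (mat [(3, []), (3, [])] (Some [NX, NB, NB, NX]) None)
      (x [NX, NB, NB, NX]) (x [NB, NB])"
      using rw[of 3 "[]" l "[NB, NB]" "rev l @ map Tm w"] sl[of "[NX, NB, NB, NX]"]
      by (simp add: mstep_def x_def del: rewrite_seq.simps)
    ultimately show ?thesis unfolding cancel_mats_def by blast
  next
    case False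
    hence B: "c = NB" using c by simp
    \<comment> \<open>The inner two of the four \<open>NB\<close> are marked, so that no
      \<open>NB NB\<close> remains to block the erasure.\<close>
    have "mstep (mat [(2, [NX]), (2, [NX])] (Some [NB, NB, NB, NB]) (Some [NX]))
      (x [c, NB, NB, c]) (x [NB, NX, NX, NB])"
      using nX rw[of 2 "[NX]" "l @ [NB]" "[]" "NB # rev l @ map Tm w"]
      sl[of "[NB, NB, NB, NB]"]
      by (simp add: mstep_def B x_def sublist_singleton del: rewrite_seq.simps)
    moreover have "\<not> sublist [NB, NB] (x [NB, NX, NX, NB])"
    proof -
      have 1: "\<not> sublist [NB, NB] (l @ [NB])" using m B by (simp add: mirrorable_def)
      have 2: "\<not> sublist [NB, NB] (NB # rev l @ map Tm w)"
        using mirrorable_right[OF m, of w] B by simp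
      have "x [NB, NX, NX, NB] = (l @ [NB]) @ NX # NX # NB # rev l @ map Tm w"
        by (simp add: x_def)
      thus ?thesis using 1 2 sublist_double_sep[of NX NB "l @ [NB]" "NX # NB # rev l @ map Tm w"]
          sublist_double_sep[of NX NB "[]" "NB # rev l @ map Tm w"] by (metis append_Nil sublist_Nil_right list.distinct(1) sym.inject(2) numeral_eq_iff num.distinct(5))
    qed
    hence "mstep (mat [(3, []), (3, [])] (Some [NB, NX, NX, NB]) (Some [NB, NB]))
      (x [NB, NX, NX, NB]) (x [NB, NB])"
      using rw[of 3 "[]" "l @ [NB]" "[]" "NB # rev l @ map Tm w"]
sl[of "[NB, NX, NX, NB]"]
      by (simp add: mstep_def x_def del: rewrite_seq.simps)
    ultimately show ?thesis unfolding cancel_mats_def by blast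
  qed
qed

lemma cancel_mirror:
  assumes m: "cancel_mats \<subseteq> mats G" and l: "mirrorable l"
  shows "(scm_step G)\<^sup>*\<^sup>* (l @ [NB, NB] @ rev l @ map Tm w) (map Tm w)"
  using l
proof (induction l rule: rev_induct)
  case Nil
  have "rewrite_seq [(2, []), (2, [])] (NB # NB # map Tm w) (map Tm w)"
    using rewrite1I[of 2 "[]" "[]" "NB # map Tm w"] rewrite1I[of 2 "[]" "[]" "map Tm w"] by auto
  hence "mstep (mat [(2, []), (2, [])] (Some [NB, NB]) (Some [NA])) (NB # NB # map Tm w) (map Tm w)"
    by (auto simp: mstep_def sublist_singleton simp del: rewrite_seq.simps)
  hence "scm_step G (NB # NB # map Tm w) (map Tm w)"
    using m unfolding scm_step_def cancel_mats_def by blast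
  thus ?case by simp
next
  case (snoc c l)
  have "c \<in> {NA, NB}" using snoc(2) by (simp add: mirrorable_def)
  from cancel_step_match[OF this snoc(2), of w] obtain y where
    "scm_step G ((l @ [c]) @ [NB, NB] @ rev (l @ [c]) @ map Tm w) y"
    "scm_step G y (l @ [NB, NB] @ rev l @ map Tm w)"
    using m unfolding scm_step_def by auto
  thus ?case using snoc.IH[OF mirrorable_butlast[OF snoc(2)]]
    by (meson converse_rtranclp_into_rtranclp)
qed

section \<open>Post systems as SCM grammars\<close>

text \<open>Post's representation with numbers as letters: \<open>z\<close> codes the terminals,
  \<open>h\<close> the separator \<open>#\<close>, \<open>V\<close> the right end
  \<open>S #\<close>, and \<open>Q\<close> is the set of pairs.\<close>

locale post_system =
  fixes T :: "'t set" and z :: "'t \<Rightarrow> nat" and h :: nat and V :: "nat list"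
    and Q :: "(nat list \<times> nat list) set"
  assumes finite_T: "finite T" and finite_Q: "finite Q"
begin

text \<open>The code is appended at the left of \<open>NG\<close>, while \<open>Tm a\<close> is put
  in front of the earlier terminals. Hence the coded side spells \<open>w\<close> reversed, and all
  words of \<open>history_pairs\<close> are reversed too.\<close>

definition term_mat :: "'t \<Rightarrow> 't matrix" where
  "term_mat a = mat [(0, codeL [z a] @ [NG, Tm a])] None None"

text \<open>Can do without a condition: the second rule is not applicable before
  \<open>switch_mat\<close> has created \<open>NX\<close>.\<close>

definition pair_mat :: "nat list \<times> nat list \<Rightarrow> 't matrix" where
  "pair_mat uv = mat [(0, codeL (fst uv) @ [NG]), (3, NX # rev (codeL (snd uv)))] None None"

text \<open>Forbidding \<open>NX\<close> prevents a second use while \<open>NG\<close> is still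
  present.\<close>

definition switch_mat :: "'t matrix" where
  "switch_mat = mat [(0, codeL [h] @ [NG, NX])] None (Some [NX])"

definition end_mat :: "'t matrix" where
  "end_mat = mat [(0, [NB]), (3, NB # rev (codeL V))] (Some [NG, NX]) None"

definition post_scm :: "'t scm" where
  "post_scm = \<lparr>nts = {0, 1, 2, 3}, tms = T, start = 0,
     mats = term_mat ` T \<union> pair_mat ` Q \<union> {switch_mat, end_mat} \<union> cancel_mats\<rparr>"

definition solves :: "'t list \<Rightarrow> (nat list \<times> nat list) list \<Rightarrow> bool" where
  "solves w ps \<longleftrightarrow>
     map z (rev w) @ h # concat (map fst ps) = concat (map snd ps) @ V"

definition emitting :: "'t sym list \<Rightarrow> bool" where
  "emitting x \<longleftrightarrow> (\<exists>w. set w \<subseteq> T \<and> x = codeL (map z (rev w)) @ NG # map Tm w)"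

text \<open>A terminal emitted after the switch ends up in \<open>w'\<close>, between \<open>NG\<close> and \<open>NX\<close>; then \<open>end_mat\<close>, which
  needs these two to be adjacent, is blocked for good.\<close>

definition pairing :: "'t sym list \<Rightarrow> bool" where
  "pairing x \<longleftrightarrow> (\<exists>p w' q w. set w \<subseteq> T \<and>
     x = codeL p @ NG # map Tm w' @ NX # rev (codeL q) @ map Tm w \<and>
     (w' = [] \<longrightarrow> (\<exists>ps \<in> lists Q. p = map z (rev w) @ h # concat (map fst ps) \<and>
        q = concat (map snd ps))))"

definition matching :: "'t sym list \<Rightarrow> bool" where
  "matching x \<longleftrightarrow> (\<exists>w ps. set w \<subseteq> T \<and> ps \<in> lists Q \<and>
     cancelling w (codeL (map z (rev w) @ h # concat (map fst ps)))
       (codeL (concat (map snd ps) @ V)) x)"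

section \<open>Soundness of the three phases\<close>

lemma post_stepE:
  assumes "scm_step post_scm x y"
  obtains (terminal) a where "a \<in> T" "rewrite1 0 (codeL [z a] @ [NG, Tm a]) x y"
  | (pair) u v x' where "(u, v) \<in> Q" "rewrite1 0 (codeL u @ [NG]) x x'"
      "rewrite1 3 (NX # rev (codeL v)) x' y"
  | (switch) "NX \<notin> set x" "rewrite1 0 (codeL [h] @ [NG, NX]) x y"
  | (last) x' where "sublist [NG, NX] x" "rewrite1 0 [NB] x x'" "rewrite1 3 (NB # rev (codeL V)) x' y"
  | (cancel) m where "m \<in> cancel_mats" "mstep m x y"
proof -
  from assms obtain m where m: "m \<in> mats post_scm" "mstep m x y" unfolding scm_step_def by blast
  from m(1) consider a where "a \<in> T" "m = term_mat a" | u v where "(u, v) \<in> Q" "m = pair_mat (u, v)"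
    | "m = switch_mat" | "m = end_mat" | "m \<in> cancel_mats"
    unfolding post_scm_def by auto
  thus ?thesis
  proof cases
    case 1
    thus ?thesis using terminal m(2) unfolding term_mat_def mstep_def by simp
  next
    case 2
    thus ?thesis using pair m(2) unfolding pair_mat_def mstep_def by auto
  next
    case 3
    thus ?thesis using switch m(2) unfolding switch_mat_def mstep_def by (simp add: sublist_singleton)
  next
    case 4
    thus ?thesis using last m(2) unfolding end_mat_def mstep_def by auto
  next
    case 5
    thus ?thesis using cancel m(2) by blast
  qed
qed

text \<open>The permitting word of each matrix contains one of the two doubles. This keeps
  cancellation out of the phases in which \<open>NG\<close> is present.\<close>

lemma not_cancel:
  assumes "\<not> sublist [NB, NB] x" "\<not> sublist [NX, NX] x" "m \<in> cancel_mats"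
  shows "\<not> mstep m x y"
proof
  assume "mstep m x y"
  moreover have "sublist [b, b] x" if "sublist P x" "sublist [b, b] P" for b P
    using that sublist_order.order.trans by blast
  ultimately show False using assms(1,2)
    by (cases rule: cancel_matsE[OF assms(3)]) (auto simp: sublist_Cons_right)
qed

lemma codeL_no_NG [simp]: "NG \<notin> set (codeL p)" and codeL_no_NX [simp]: "NX \<notin> set (codeL p)"
  using set_codeL[of p] by auto

lemma codeL_no_BB [simp]: "\<not> sublist [NB, NB] (codeL p)"
  by (meson mirrorable_codeL mirrorable_def)

lemma emitting_step:
  assumes "emitting x" "scm_step post_scm x y"
  shows "emitting y \<or> pairing y"
proof -
  from assms(1) obtain w where w: "set w \<subseteq> T" and x: "x = codeL (map z (rev w)) @ NG # map Tm w"
    unfolding emitting_def by blast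
  have X: "NX \<notin> set x" by (auto simp: x)
  have repl: "v = codeL (map z (rev w)) @ r @ map Tm w" if "rewrite1 0 r x v" for r v
    using rewrite1_unique[OF that[unfolded x]] by auto
  from assms(2) show ?thesis
  proof (cases rule: post_stepE)
    case (terminal a)
    from repl[OF terminal(2)] have "y = codeL (map z (rev (a # w))) @ NG # map Tm (a # w)" by simp
    moreover have "set (a # w) \<subseteq> T" using w terminal(1) by simp
    ultimately show ?thesis unfolding emitting_def by blast
  next
    case (pair u v x')
    from rewrite1_mem[OF pair(3)] repl[OF pair(2)] show ?thesis by auto
  next
    case switch
    from repl[OF switch(2)] have "y = codeL (map z (rev w) @ [h]) @ NG # map Tm [] @ NX # rev (codeL []) @ map Tm w"
      by simp
    moreover have "map z (rev w) @ [h] = map z (rev w) @ h # concat (map fst []) \<and>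
        [] = concat (map snd [])" "[] \<in> lists Q" by simp_all
    ultimately show ?thesis unfolding pairing_def using w by blast
  next
    case last
    thus ?thesis using X set_mono_sublist by fastforce
  next
    case (cancel m)
    have "\<not> sublist [NX, NX] x" using X by (rule sublist_double_notin)
    moreover have "\<not> sublist [NB, NB] x"
      unfolding x by (auto simp: sublist_double_sep intro!: sublist_double_notin)
    ultimately show ?thesis using not_cancel cancel by blast
  qed
qed

lemma pairing_step:
  assumes "pairing x" "scm_step post_scm x y"
  shows "pairing y \<or> matching y"
proof -
  from assms(1) obtain p w' q w where w: "set w \<subseteq> T"
    and x: "x = codeL p @ NG # map Tm w' @ NX # rev (codeL q) @ map Tm w"
    and ps: "w' = [] \<Longrightarrow> \<exists>ps \<in> lists Q. p = map z (rev w) @ h # concat (map fst ps) \<and>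
        q = concat (map snd ps)"
    unfolding pairing_def by blast
  have repl: "v = codeL p @ r @ map Tm w' @ NX # rev (codeL q) @ map Tm w" if "rewrite1 0 r x v" for r v
    using rewrite1_unique[OF that[unfolded x]] by auto
  \<comment> \<open>\<open>NX \<notin> set r\<close> keeps \<open>NX\<close> unique when the second
    rule is applied.\<close>
  have repl2: "v = codeL p @ r @ map Tm w' @ s @ rev (codeL q) @ map Tm w"
    if "rewrite1 0 r x u" "rewrite1 3 s u v" "NX \<notin> set r" for r u v s
  proof -
    have u: "u = (codeL p @ r @ map Tm w') @ NX # rev (codeL q) @ map Tm w" using repl[OF that(1)] by simp
    show ?thesis using rewrite1_unique[OF that(2)[unfolded u]] that(3) by auto
  qed
  from assms(2) show ?thesis
  proof (cases rule: post_stepE)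
    case (terminal a)
    from repl[OF terminal(2)]
    have "y = codeL (p @ [z a]) @ NG # map Tm (a # w') @ NX # rev (codeL q) @ map Tm w" by simp
    thus ?thesis unfolding pairing_def using w by blast
  next
    case (pair u v x')
    from repl2[OF pair(2,3)]
    have "y = codeL (p @ u) @ NG # map Tm w' @ NX # rev (codeL (q @ v)) @ map Tm w" by simp
    moreover have "\<exists>ps \<in> lists Q. p @ u = map z (rev w) @ h # concat (map fst ps) \<and>
        q @ v = concat (map snd ps)" if "w' = []"
    proof -
      from ps[OF that] obtain ps where "ps \<in> lists Q" "p = map z (rev w) @ h # concat (map fst ps)"
        "q = concat (map snd ps)" by blast
      thus ?thesis using pair(1) by (intro bexI[of _ "ps @ [(u, v)]"]) auto
    qed
    ultimately show ?thesis unfolding pairing_def using w by blast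
  next
    case switch
    thus ?thesis by (simp add: x)
  next
    case (last x')
    \<comment> \<open>The unique \<open>NG\<close> locates the permitting word; as \<open>w'\<close>
      consists of terminals, an adjacent \<open>NX\<close> means that \<open>w'\<close> is
      empty.\<close>
    from last(1) obtain a b where "x = a @ NG # NX # b" by (auto simp: sublist_def)
    moreover from this have "NG \<notin> set a" "NG \<notin> set (NX # b)"
      using arg_cong[OF x, of "\<lambda>x. count_list x NG"]
      by (auto simp: count_list_0_iff image_iff split: if_splits)
    ultimately have "map Tm w' @ NX # rev (codeL q) @ map Tm w = NX # b"
      using x append_Cons_eq_iff[of NG "codeL p" "map Tm w' @ NX # rev (codeL q) @ map Tm w" a "NX # b"] by auto
    hence w': "w' = []" by (cases w') auto
    from ps[OF this] obtain ps where "ps \<in> lists Q" "p = map z (rev w) @ h # concat (map fst ps)"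
      "q = concat (map snd ps)" by blast
    moreover from repl2[OF last(2,3)] have "y = codeL p @ [NB, NB] @ rev (codeL (q @ V)) @ map Tm w"
      using w' by simp
    hence "cancelling w (codeL p) (codeL (q @ V)) y"
      unfolding cancelling_def using mirrorable_codeL by blast
    ultimately show ?thesis unfolding matching_def using w by blast
  next
    case (cancel m)
    have "\<not> sublist [NX, NX] x"
    proof
      assume "sublist [NX, NX] x"
      then obtain a b where "x = a @ NX # NX # b" by (auto simp: sublist_def)
      from arg_cong[OF this[unfolded x], of "\<lambda>x. count_list x NX"] show False
        by (auto simp: count_list_0_iff image_iff)
    qed
    moreover have "\<not> sublist [NB, NB] x"
    proof -
      have "\<not> sublist [NB, NB] (rev (codeL q) @ map Tm w)"
        using mirrorable_right mirrorable_codeL by blast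
      thus ?thesis
        unfolding x by (auto simp: sublist_double_sep intro!: sublist_double_notin)
    qed
    ultimately show ?thesis using not_cancel cancel by blast
  qed
qed

lemma matching_step:
  assumes "matching x" "scm_step post_scm x y"
  shows "matching y"
proof -
  from assms(1) obtain w ps where *: "set w \<subseteq> T" "ps \<in> lists Q"
     "cancelling w (codeL (map z (rev w) @ h # concat (map fst ps)))
       (codeL (concat (map snd ps) @ V)) x" unfolding matching_def by blast
  from assms(2) show ?thesis
  proof (cases rule: post_stepE)
    case (cancel m)
    thus ?thesis using * cancelling_step unfolding matching_def by blast
  qed (use cancelling_NG[OF *(3)] rewrite1_mem in blast)+
qed

lemma post_scm_sound:
  assumes "w \<in> scm_lang post_scm"
  shows "set w \<subseteq> T \<and> (\<exists>ps \<in> lists Q. solves w ps)"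
proof -
  from assms have "(scm_step post_scm)\<^sup>*\<^sup>* [NG] (map Tm w)"
    by (simp add: scm_lang_def post_scm_def)
  hence "emitting (map Tm w) \<or> pairing (map Tm w) \<or> matching (map Tm w)"
  proof (induction rule: rtranclp_induct)
    case base
    have "emitting [NG]" unfolding emitting_def by (intro exI[of _ "[]"]) simp
    thus ?case by simp
  next
    case step
    thus ?case using emitting_step pairing_step matching_step by blast
  qed
  moreover have "\<not> emitting (map Tm w)"
  proof
    assume "emitting (map Tm w)"
    hence "NG \<in> set (map Tm w)" unfolding emitting_def by force
    thus False by auto
  qed
  moreover have "\<not> pairing (map Tm w)"
  proof
    assume "pairing (map Tm w)"
    hence "NG \<in> set (map Tm w)" unfolding pairing_def by force
    thus False by auto
  qed
  ultimately have "matching (map Tm w)" by blast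
  thus ?thesis unfolding matching_def solves_def
    using cancelling_final codeL_inj by blast
qed

section \<open>Completeness and size of the grammar of a Post system\<close>

lemma term_mat_step:
  "a \<in> T \<Longrightarrow> scm_step post_scm (p @ NG # q) (p @ (codeL [z a] @ [NG, Tm a]) @ q)"
  unfolding scm_step_def post_scm_def
  by (rule bexI[of _ "term_mat a"]) (use rewrite1I[of 0 "codeL [z a] @ [NG, Tm a]" p q] in \<open>auto simp: mstep_def term_mat_def\<close>)

lemma rewrite_seq_two:
  "rewrite_seq [(j, u), (k, v)] (p @ Nt j # q @ Nt k # r) (p @ u @ q @ v @ r)"
  using rewrite1I[of j u p "q @ Nt k # r"] rewrite1I[of k v "p @ u @ q" r] by auto

lemma post_scm_complete:
  assumes w: "set w \<subseteq> T" and ps: "ps \<in> lists Q" and s: "solves w ps"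
  shows "w \<in> scm_lang post_scm"
proof -
  let ?R = "(scm_step post_scm)\<^sup>*\<^sup>*"
  have "?R [NG] (codeL (map z (rev w)) @ NG # map Tm w)"
    using w
  proof (induction w)
    case (Cons a w)
    have "scm_step post_scm (codeL (map z (rev w)) @ NG # map Tm w)
      (codeL (map z (rev (a # w))) @ NG # map Tm (a # w))"
      using term_mat_step[of a "codeL (map z (rev w))" "map Tm w"] Cons(2) by simp
    thus ?case using Cons by (meson rtranclp.rtrancl_into_rtrancl set_subset_Cons subset_trans)
  qed simp
  also have "scm_step post_scm (codeL (map z (rev w)) @ NG # map Tm w)
    (codeL (map z (rev w) @ [h]) @ NG # NX # map Tm w)"
    unfolding scm_step_def post_scm_def
    by (rule bexI[of _ switch_mat])
      (use rewrite1I[of 0 "codeL [h] @ [NG, NX]" "codeL (map z (rev w))" "map Tm w"] in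
        \<open>auto simp: mstep_def switch_mat_def sublist_singleton\<close>)
  also have "?R (codeL (map z (rev w) @ [h]) @ NG # NX # map Tm w)
    (codeL (map z (rev w) @ h # concat (map fst ps)) @ NG # NX # rev (codeL (concat (map snd ps))) @ map Tm w)"
    using ps
  proof (induction ps rule: rev_induct)
    case (snoc uv ps)
    let ?p = "codeL (map z (rev w) @ h # concat (map fst ps))"
    let ?q = "rev (codeL (concat (map snd ps))) @ map Tm w"
    have "scm_step post_scm (?p @ NG # NX # ?q)
      (?p @ (codeL (fst uv) @ [NG]) @ (NX # rev (codeL (snd uv))) @ ?q)"
      unfolding scm_step_def post_scm_def
      by (rule bexI[of _ "pair_mat uv"])
        (use snoc(2) rewrite_seq_two[of 0 "codeL (fst uv) @ [NG]" 3 "NX # rev (codeL (snd uv))" ?p "[]" ?q] in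
          \<open>auto simp: mstep_def pair_mat_def simp del: rewrite_seq.simps\<close>)
    thus ?case using snoc by simp
  qed simp
  also have "scm_step post_scm
    (codeL (map z (rev w) @ h # concat (map fst ps)) @ NG # NX # rev (codeL (concat (map snd ps))) @ map Tm w)
    (codeL (map z (rev w) @ h # concat (map fst ps)) @ [NB, NB] @ rev (codeL (concat (map snd ps) @ V)) @ map Tm w)"
    (is "scm_step _ (?p @ NG # NX # ?q) _")
    unfolding scm_step_def post_scm_def
    by (rule bexI[of _ end_mat])
      (use rewrite_seq_two[of 0 "[NB]" 3 "NB # rev (codeL V)" ?p "[]" ?q]
          sublist_appendI[of "[NG, NX]" ?p ?q] in
        \<open>auto simp: mstep_def end_mat_def simp del: rewrite_seq.simps\<close>)
  also have "?R \<dots> (map Tm w)"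
    unfolding s[unfolded solves_def]
    by (rule cancel_mirror[OF _ mirrorable_codeL]) (auto simp: post_scm_def)
  finally show ?thesis using w by (simp add: scm_lang_def post_scm_def)
qed

lemma post_scm_lang: "scm_lang post_scm = {w. set w \<subseteq> T \<and> (\<exists>ps \<in> lists Q. solves w ps)}"
  using post_scm_sound post_scm_complete by blast

lemma post_scm_SCM: "scm_lang post_scm \<in> SCM 4 3 4 7 2 6"
proof -
  have fin: "finite (cancel_mats :: 't matrix set)" unfolding cancel_mats_def by simp
  have V: "c \<in> symbols {0, 1, 2, 3} T" if "c \<in> set (codeL p)" for p and c :: "'t sym"
    using that set_codeL[of p, where ?'a = 't] unfolding symbols_def by auto
  have S: "NG \<in> symbols {0, 1, 2, 3} T" "NA \<in> symbols {0, 1, 2, 3} T"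
    "NB \<in> symbols {0, 1, 2, 3} T" "NX \<in> symbols {0, 1, 2, 3} T"
    "\<And>a. a \<in> T \<Longrightarrow> Tm a \<in> symbols {0, 1, 2, 3} T"
    unfolding symbols_def by auto
  have ok: "matrix_ok {0, 1, 2, 3} (symbols {0, 1, 2, 3} T) r" if "r \<in> mats post_scm" for r
    using that V S unfolding post_scm_def matrix_ok_def
    by (auto simp: term_mat_def pair_mat_def switch_mat_def end_mat_def cancel_mats_def cond_ok_def)
  have "scm_wf post_scm"
    using ok fin finite_T finite_Q unfolding scm_wf_def by (simp add: post_scm_def)
  moreover have "cond_len (pcond r) \<le> 4 \<and> cond_len (fcond r) \<le> 3 \<and> length (rules r) \<le> 2"
    if "r \<in> mats post_scm" for r
    using that unfolding post_scm_def
    by (auto simp: term_mat_def pair_mat_def switch_mat_def end_mat_def cancel_mats_def cond_len_def)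
  moreover have "card {r \<in> mats post_scm. conditional r} \<le> 7"
  proof -
    have "{r \<in> mats post_scm. conditional r} \<subseteq> {switch_mat, end_mat} \<union> cancel_mats"
      by (auto simp: post_scm_def term_mat_def pair_mat_def conditional_def)
    hence "card {r \<in> mats post_scm. conditional r} \<le> card ({switch_mat, end_mat} \<union> cancel_mats)"
      by (intro card_mono) (auto simp: fin)
    also have "\<dots> \<le> 7" unfolding cancel_mats_def by (auto intro!: card_insert_le_m1)
    finally show ?thesis .
  qed
  moreover have "card {r \<in> mats post_scm. non_simple r} \<le> 6"
  proof -
    have "{r \<in> mats post_scm. non_simple r} \<subseteq> cancel_mats"
      by (auto simp: post_scm_def term_mat_def pair_mat_def non_simple_def switch_mat_def end_mat_def)
    hence "card {r \<in> mats post_scm. non_simple r} \<le> card (cancel_mats :: 't matrix set)"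
      by (intro card_mono) (auto simp: fin)
    \<comment> \<open>A crude count: all five matrices of \<open>cancel_mats\<close>, simple or
      not.\<close>
    also have "\<dots> \<le> 6" unfolding cancel_mats_def by (auto intro!: card_insert_le_m1)
    finally show ?thesis .
  qed
  moreover have "card (nts post_scm) \<le> 4" by (simp add: post_scm_def)
  ultimately show ?thesis unfolding SCM_def by blast
qed

end

section \<open>Derivation histories as Post systems\<close>

text \<open>\<open>None\<close> is the separator \<open>#\<close>. The second component of a pair is
  read and the first is written, so a production is undone: the history leads from the generated
  word back to the start symbol.\<close>

definition history_pairs :: "'t ugram \<Rightarrow> ('t sym option list \<times> 't sym option list) set" where
  "history_pairs G =
     (\<lambda>c. ([c], [c])) ` insert None (Some ` symbols (unts G) (utms G)) \<union>
     (\<lambda>(\<alpha>, \<beta>). (map Some (rev \<alpha>), map Some (rev \<beta>))) ` prods G"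

text \<open>What an undone production reads contains no separator, so it lies within the unread part
  of the current sentential form.\<close>

lemma map_Some_prefix:
  "map Some y @ None # t = map Some v @ t' \<Longrightarrow> \<exists>y'. y = v @ y' \<and> t' = map Some y' @ None # t"
proof (induction v arbitrary: y)
  case (Cons a v)
  thus ?case by (cases y) auto
qed auto

text \<open>The word \<open>y\<close>, \<open>None\<close>, \<open>x\<close> is the current content of a queue: \<open>y\<close> is the unread part of the
  old sentential form, \<open>x\<close> the part of the new one written so far, both reversed.\<close>

lemma history_sound:
  assumes "ps \<in> lists (history_pairs G)"
    and "map Some y @ None # map Some x @ concat (map fst ps) =
      concat (map snd ps) @ [Some (Nt (ustart G)), None]"
  shows "(ustep G)\<^sup>*\<^sup>* [Nt (ustart G)] (rev (x @ y))"
  using assms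
proof (induction ps arbitrary: x y rule: list.induct)
  case Nil
  hence "y = [Nt (ustart G)] \<and> x = []" by (cases y; cases "tl y") auto
  thus ?case by simp
next
  case (Cons uv ps)
  from Cons.prems(1) have ps: "ps \<in> lists (history_pairs G)" and "uv \<in> history_pairs G" by auto
  then consider c where "uv = ([Some c], [Some c])" | "uv = ([None], [None])"
    | \<alpha> \<beta> where "(\<alpha>, \<beta>) \<in> prods G" "uv = (map Some (rev \<alpha>), map Some (rev \<beta>))"
    unfolding history_pairs_def by auto
  thus ?case
  proof cases
    case 1
    then obtain y' where y: "y = c # y'" using Cons.prems(2) by (cases y) auto
    hence "map Some y' @ None # map Some (x @ [c]) @ concat (map fst ps) =
      concat (map snd ps) @ [Some (Nt (ustart G)), None]" using Cons.prems(2) 1 by simp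
    from Cons.IH[OF ps this] show ?thesis by (simp add: y)
  next
    case 2
    hence y: "y = []" using Cons.prems(2) by (cases y) auto
    \<comment> \<open>Reading the separator starts the next sweep: \<open>x\<close> becomes the word
      to be read, and nothing is written yet.\<close>
    hence "map Some x @ None # map Some [] @ concat (map fst ps) =
      concat (map snd ps) @ [Some (Nt (ustart G)), None]" using Cons.prems(2) 2 by simp
    from Cons.IH[OF ps this] show ?thesis by (simp add: y)
  next
    case 3
    have "map Some y @ None # map Some (x @ rev \<alpha>) @ concat (map fst ps) =
      map Some (rev \<beta>) @ concat (map snd ps) @ [Some (Nt (ustart G)), None]"
      using Cons.prems(2) 3 by simp
    from map_Some_prefix[OF this] obtain y' where y: "y = rev \<beta> @ y'"
      and "map Some y' @ None # map Some (x @ rev \<alpha>) @ concat (map fst ps) =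
        concat (map snd ps) @ [Some (Nt (ustart G)), None]" by metis
    \<comment> \<open>Later pairs describe earlier derivation steps, so the new step goes at the end
      of the derivation.\<close>
    from Cons.IH[OF ps this(2)] have "(ustep G)\<^sup>*\<^sup>* [Nt (ustart G)] (rev y' @ \<alpha> @ rev x)" by simp
    moreover have "ustep G (rev y' @ \<alpha> @ rev x) (rev y' @ \<beta> @ rev x)"
      using 3(1) unfolding ustep_def by blast
    ultimately show ?thesis by (simp add: y)
  qed
qed

lemma history_complete:
  assumes wf: "ugram_wf G" and der: "(ustep G)\<^sup>*\<^sup>* [Nt (ustart G)] s"
  shows "set s \<subseteq> symbols (unts G) (utms G) \<and>
    (\<exists>ps \<in> lists (history_pairs G). map Some (rev s) @ None # concat (map fst ps) =
      concat (map snd ps) @ [Some (Nt (ustart G)), None])"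
  using der
proof (induction rule: rtranclp_induct)
  case base
  show ?case using wf by (auto simp: ugram_wf_def symbols_def intro!: bexI[of _ "[]"])
next
  case (step s s')
  from step(2) obtain \<alpha> \<beta> p q where r: "(\<alpha>, \<beta>) \<in> prods G" and s: "s = p @ \<alpha> @ q"
    and s': "s' = p @ \<beta> @ q" unfolding ustep_def by auto
  from step.IH obtain ps where ps: "ps \<in> lists (history_pairs G)"
    "map Some (rev s) @ None # concat (map fst ps) =
      concat (map snd ps) @ [Some (Nt (ustart G)), None]" by blast
  have sub: "set p \<union> set q \<subseteq> symbols (unts G) (utms G)" using step.IH s by auto
  have "set \<beta> \<subseteq> symbols (unts G) (utms G)" using wf r unfolding ugram_wf_def by blast
  hence sub': "set s' \<subseteq> symbols (unts G) (utms G)" using sub s' by auto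
  define cp where "cp t = map (\<lambda>c. ([Some c], [Some c])) (rev t)" for t :: "'a sym list"
  have cp: "concat (map fst (cp t)) = map Some (rev t)" "concat (map snd (cp t)) = map Some (rev t)" for t
    unfolding cp_def by (induction t) auto
  have cp_in: "cp t \<in> lists (history_pairs G)" if "set t \<subseteq> symbols (unts G) (utms G)" for t
  proof -
    have *: "([Some c], [Some c]) \<in> history_pairs G" if "c \<in> symbols (unts G) (utms G)" for c
      using that unfolding history_pairs_def by blast
    show ?thesis using that unfolding cp_def by (auto intro!: *)
  qed
  \<comment> \<open>One sweep per derivation step, copying what surrounds the production;
    \<open>q\<close> comes first because the words are reversed.\<close>
  define ps' where "ps' = cp q @ (map Some (rev \<alpha>), map Some (rev \<beta>)) # cp p @ ([None], [None]) # ps"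
  have "(map Some (rev \<alpha>), map Some (rev \<beta>)) \<in> history_pairs G" "([None], [None]) \<in> history_pairs G"
    using r unfolding history_pairs_def by force+
  hence "ps' \<in> lists (history_pairs G)" unfolding ps'_def using cp_in sub ps(1) by auto
  moreover have "map Some (rev s') @ None # concat (map fst ps') =
      concat (map snd ps') @ [Some (Nt (ustart G)), None]"
    using ps(2) by (simp add: s s' ps'_def cp)
  ultimately show ?case using sub' by blast
qed

lemma RE_subset_SCM: "(RE :: 't list set set) \<subseteq> SCM 4 3 4 7 2 6"
proof
  fix L :: "'t list set"
  assume "L \<in> RE"
  then obtain G :: "'t ugram" where wf: "ugram_wf G" and L: "L = ugram_lang G" unfolding RE_def by blast
  define \<Sigma> where "\<Sigma> = insert None (Some ` symbols (unts G) (utms G))"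
  have "finite \<Sigma>" using wf by (simp add: \<Sigma>_def ugram_wf_def symbols_def)
  then obtain e :: "'t sym option \<Rightarrow> nat" where e: "inj_on e \<Sigma>"
    using finite_imp_inj_to_nat_seg by metis
  define enc where "enc = (\<lambda>(u, v). (map e u, map e v))"
  let ?Q = "enc ` history_pairs G"
  let ?z = "\<lambda>a. e (Some (Tm a))"
  let ?V = "map e [Some (Nt (ustart G)), None]"
  have finT: "finite (utms G)" and finQ: "finite ?Q"
    using wf by (auto simp: ugram_wf_def history_pairs_def symbols_def)
  interpret post_system "utms G" ?z "e None" ?V ?Q
    by unfold_locales (fact finT finQ)+
  have \<Sigma>: "set u \<subseteq> \<Sigma>" "set v \<subseteq> \<Sigma>" if "(u, v) \<in> history_pairs G" for u v
    using that wf unfolding history_pairs_def \<Sigma>_def ugram_wf_def by fastforce+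
  have solves_iff: "solves w (map enc ps) \<longleftrightarrow> map Some (rev (map Tm w)) @ None # concat (map fst ps) =
      concat (map snd ps) @ [Some (Nt (ustart G)), None]" (is "_ \<longleftrightarrow> ?l = ?r")
    if w: "set w \<subseteq> utms G" and ps: "ps \<in> lists (history_pairs G)" for w ps
  proof -
    have "concat (map fst (map enc ps)) = map e (concat (map fst ps))"
      "concat (map snd (map enc ps)) = map e (concat (map snd ps))" for ps
      by (induction ps) (auto simp: enc_def)
    hence "solves w (map enc ps) \<longleftrightarrow> map e ?l = map e ?r"
      unfolding solves_def by (simp add: rev_map comp_def)
    \<comment> \<open>\<open>e\<close> is injective on \<open>\<Sigma>\<close> only, so all letters
      of both sides must belong to it.\<close>
    moreover have "set ?l \<union> set ?r \<subseteq> \<Sigma>"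
    proof -
      have "set (concat (map fst ps)) \<subseteq> \<Sigma>" "set (concat (map snd ps)) \<subseteq> \<Sigma>"
        using ps \<Sigma> by fastforce+
      thus ?thesis using w wf by (auto simp: \<Sigma>_def symbols_def ugram_wf_def)
    qed
    hence "inj_on e (set ?l \<union> set ?r)" by (rule inj_on_subset[OF e])
    hence "map e ?l = map e ?r \<longleftrightarrow> ?l = ?r" by (rule inj_on_map_eq_map)
    ultimately show ?thesis by blast
  qed
  have "scm_lang post_scm = L"
  proof (rule set_eqI)
    fix w
    have "w \<in> scm_lang post_scm \<longleftrightarrow> set w \<subseteq> utms G \<and> (\<exists>ps \<in> lists (history_pairs G). solves w (map enc ps))"
      unfolding post_scm_lang by (simp add: lists_image)
    also have "\<dots> \<longleftrightarrow> set w \<subseteq> utms G \<and> (\<exists>ps \<in> lists (history_pairs G).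
      map Some (rev (map Tm w)) @ None # concat (map fst ps) =
      concat (map snd ps) @ [Some (Nt (ustart G)), None])" (is "_ \<longleftrightarrow> _ \<and> ?ex")
      using solves_iff by blast
    also have "\<dots> \<longleftrightarrow> set w \<subseteq> utms G \<and> (ustep G)\<^sup>*\<^sup>* [Nt (ustart G)] (map Tm w)"
    proof -
      have "?ex \<longleftrightarrow> (ustep G)\<^sup>*\<^sup>* [Nt (ustart G)] (map Tm w)"
      proof
        assume ?ex
        thus "(ustep G)\<^sup>*\<^sup>* [Nt (ustart G)] (map Tm w)"
          using history_sound[of _ G "rev (map Tm w)" "[]"] by auto
      next
        assume "(ustep G)\<^sup>*\<^sup>* [Nt (ustart G)] (map Tm w)"
        thus ?ex by (rule history_complete[OF wf, THEN conjunct2])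
      qed
      thus ?thesis by blast
    qed
    finally show "w \<in> scm_lang post_scm \<longleftrightarrow> w \<in> L" by (simp add: L ugram_lang_def)
  qed
  thus "L \<in> SCM 4 3 4 7 2 6" using post_scm_SCM by simp
qed

section \<open>Simulating SCM grammars by unrestricted grammars\<close>

text \<open>\<open>ustep\<close> over an arbitrary symbol type, so that structured head states can
  serve as nonterminals; numbering them is left to \<open>RE_rename\<close>.\<close>

definition rstep :: "('a list \<times> 'a list) set \<Rightarrow> 'a list \<Rightarrow> 'a list \<Rightarrow> bool" where
  "rstep R x y \<longleftrightarrow> (\<exists>(\<alpha>, \<beta>) \<in> R. \<exists>p q. x = p @ \<alpha> @ q \<and> y = p @ \<beta> @ q)"

lemma rstepI: "(\<alpha>, \<beta>) \<in> R \<Longrightarrow> rstep R (p @ \<alpha> @ q) (p @ \<beta> @ q)"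
  unfolding rstep_def by blast

lemma rstepE:
  assumes "rstep R x y"
  obtains \<alpha> \<beta> p q where "(\<alpha>, \<beta>) \<in> R" "x = p @ \<alpha> @ q" "y = p @ \<beta> @ q"
  using assms unfolding rstep_def by auto

lemma rstep_map: "rstep R x y \<Longrightarrow> rstep ((\<lambda>(\<alpha>, \<beta>). (map f \<alpha>, map f \<beta>)) ` R) (map f x) (map f y)"
  by (erule rstepE) (force simp: rstep_def)

text \<open>By injectivity on the symbols involved, an occurrence of \<open>map f \<alpha>\<close>
  in \<open>map f x\<close> comes from an occurrence of \<open>\<alpha>\<close> in
  \<open>x\<close>.\<close>

lemma rstep_unmap:
  assumes s: "rstep ((\<lambda>(\<alpha>, \<beta>). (map f \<alpha>, map f \<beta>)) ` R) (map f x) y"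
    and f: "inj_on f A" and x: "set x \<subseteq> A" and R: "\<And>\<alpha> \<beta>. (\<alpha>, \<beta>) \<in> R \<Longrightarrow> set \<alpha> \<subseteq> A"
  shows "\<exists>y'. y = map f y' \<and> rstep R x y'"
proof -
  from s obtain \<alpha> \<beta> p q where r: "(\<alpha>, \<beta>) \<in> R" "map f x = p @ map f \<alpha> @ q" "y = p @ map f \<beta> @ q"
    by (auto elim!: rstepE)
  from map_eq_append_conv[THEN iffD1, OF r(2)]
  obtain p' t where 1: "x = p' @ t" "p = map f p'" "map f \<alpha> @ q = map f t" by blast
  from map_eq_append_conv[THEN iffD1, OF 1(3)[symmetric]] obtain \<alpha>' q' where 2: "t = \<alpha>' @ q'" "map f \<alpha> = map f \<alpha>'" "q = map f q'" by blast
  have "inj_on f (set \<alpha> \<union> set \<alpha>')" by (rule inj_on_subset[OF f]) (use R[OF r(1)] x 1 2 in auto)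
  hence "\<alpha>' = \<alpha>" using 2(2) inj_on_map_eq_map by metis
  hence "x = p' @ \<alpha> @ q'" "y = map f (p' @ \<beta> @ q')" using 1(1,2) 2(1,3) r(3) by simp_all
  thus ?thesis using rstepI[OF r(1), of p' q'] by blast
qed

lemma RE_rename:
  fixes R :: "(('n + 't) list \<times> ('n + 't) list) set"
  assumes fin: "finite R" "finite T" "finite N" and s: "s \<in> N"
    and R: "\<And>\<alpha> \<beta>. (\<alpha>, \<beta>) \<in> R \<Longrightarrow> set \<alpha> \<subseteq> N <+> T \<and> set \<beta> \<subseteq> N <+> T \<and> (\<exists>n. Inl n \<in> set \<alpha>)"
  shows "{w. set w \<subseteq> T \<and> (rstep R)\<^sup>*\<^sup>* [Inl s] (map Inr w)} \<in> RE"
proof -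
  obtain e :: "'n \<Rightarrow> nat" where e: "inj_on e N" using finite_imp_inj_to_nat_seg[OF fin(3)] by metis
  define f :: "'n + 't \<Rightarrow> 't sym" where "f = case_sum (\<lambda>n. Nt (e n)) Tm"
  let ?g = "\<lambda>(\<alpha>, \<beta>). (map f \<alpha>, map f \<beta>)"
  define G where "G = \<lparr>unts = e ` N, utms = T, ustart = e s, prods = ?g ` R\<rparr>"
  have f: "inj_on f (N <+> T)" 
  proof (rule inj_onI)
    fix a b
    assume "a \<in> N <+> T" "b \<in> N <+> T" "f a = f b"
    thus "a = b" by (cases a; cases b) (auto simp: f_def dest: inj_onD[OF e])
  qed
  have fV: "f ` (N <+> T) = symbols (unts G) (utms G)"
    by (simp add: f_def symbols_def G_def Plus_def image_Un image_image Un_commute)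
  have "ugram_wf G"
  proof -
    have *: "set (map f \<alpha>) \<subseteq> symbols (unts G) (utms G) \<and> set (map f \<beta>) \<subseteq> symbols (unts G) (utms G)
      \<and> (\<exists>A \<in> unts G. Nt A \<in> set (map f \<alpha>))" if r: "(\<alpha>, \<beta>) \<in> R" for \<alpha> \<beta>
    proof (intro conjI)
      show "set (map f \<alpha>) \<subseteq> symbols (unts G) (utms G)" "set (map f \<beta>) \<subseteq> symbols (unts G) (utms G)"
        unfolding fV[symmetric] using R[OF r] by auto
      from R[OF r] obtain n where n: "Inl n \<in> set \<alpha>" "n \<in> N" by auto
      hence "f (Inl n) \<in> set (map f \<alpha>)" "e n \<in> unts G" by (auto simp: G_def)
      thus "\<exists>A \<in> unts G. Nt A \<in> set (map f \<alpha>)" by (auto simp: f_def)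
    qed
    have "\<forall>(\<alpha>, \<beta>) \<in> prods G. set \<alpha> \<subseteq> symbols (unts G) (utms G) \<and>
        set \<beta> \<subseteq> symbols (unts G) (utms G) \<and> (\<exists>A \<in> unts G. Nt A \<in> set \<alpha>)"
    proof (rule ballI)
      fix r
      assume "r \<in> prods G"
      then obtain \<alpha> \<beta> where "(\<alpha>, \<beta>) \<in> R" "r = (map f \<alpha>, map f \<beta>)" by (auto simp: G_def)
      thus "case r of (\<alpha>, \<beta>) \<Rightarrow> set \<alpha> \<subseteq> symbols (unts G) (utms G) \<and>
        set \<beta> \<subseteq> symbols (unts G) (utms G) \<and> (\<exists>A \<in> unts G. Nt A \<in> set \<alpha>)"
        using * by blast
    qed
    moreover have "finite (unts G)" "finite (utms G)" "finite (prods G)" "ustart G \<in> unts G"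
      using fin s by (auto simp: G_def)
    ultimately show ?thesis unfolding ugram_wf_def by blast
  qed
  have ustep: "ustep G = rstep (?g ` R)" by (auto simp: fun_eq_iff ustep_def rstep_def G_def)
  have fwd: "(ustep G)\<^sup>*\<^sup>* [Nt (e s)] (map f x)" if "(rstep R)\<^sup>*\<^sup>* [Inl s] x" for x
    using that
  proof (induction rule: rtranclp_induct)
    case base
    show ?case by (simp add: f_def)
  next
    case (step y z)
    thus ?case using rstep_map[OF step(2), of f] unfolding ustep by simp
  qed
  have bwd: "\<exists>x. y = map f x \<and> set x \<subseteq> N <+> T \<and> (rstep R)\<^sup>*\<^sup>* [Inl s] x"
    if "(ustep G)\<^sup>*\<^sup>* [Nt (e s)] y" for y
    using that
  proof (induction rule: rtranclp_induct)
    case base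
    show ?case using s by (intro exI[of _ "[Inl s]"]) (simp add: f_def InlI)
  next
    case (step y z)
    then obtain x where x: "y = map f x" "set x \<subseteq> N <+> T" "(rstep R)\<^sup>*\<^sup>* [Inl s] x" by blast
    from rstep_unmap[OF step(2)[unfolded ustep x(1)] f x(2)] R
    obtain x' where x': "z = map f x'" "rstep R x x'" by metis
    have "set x' \<subseteq> N <+> T" using x'(2) x(2) by (elim rstepE) (auto dest: R)
    moreover have "(rstep R)\<^sup>*\<^sup>* [Inl s] x'" using x(3) x'(2) by simp
    ultimately show ?case using x'(1) by blast
  qed
  have inv: "x = map Inr w" if "map f x = map Tm w" for x :: "('n + 't) list" and w
    using that by (induction x arbitrary: w) (auto simp: f_def Cons_eq_map_conv split: sum.splits)
  have "(ustep G)\<^sup>*\<^sup>* [Nt (e s)] (map Tm w) \<longleftrightarrow> (rstep R)\<^sup>*\<^sup>* [Inl s] (map Inr w)" for w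
  proof
    assume "(ustep G)\<^sup>*\<^sup>* [Nt (e s)] (map Tm w)"
    from bwd[OF this] obtain x where "map f x = map Tm w" "(rstep R)\<^sup>*\<^sup>* [Inl s] x" by metis
    thus "(rstep R)\<^sup>*\<^sup>* [Inl s] (map Inr w)" using inv by metis
  next
    assume "(rstep R)\<^sup>*\<^sup>* [Inl s] (map Inr w)"
    from fwd[OF this] show "(ustep G)\<^sup>*\<^sup>* [Nt (e s)] (map Tm w)" by (simp add: f_def comp_def)
  qed
  hence "{w. set w \<subseteq> T \<and> (rstep R)\<^sup>*\<^sup>* [Inl s] (map Inr w)} = ugram_lang G"
    unfolding ugram_lang_def by (simp add: G_def)
  thus ?thesis unfolding RE_def using \<open>ugram_wf G\<close> by blast
qed

text \<open>The simulating grammar rewrites words of the form left marker, \<open>x\<close>, head, \<open>y\<close>, right marker.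
  The head walks freely through the word while it looks for the permitting word (\<open>CheckP\<close>) or for
  a symbol to rewrite (\<open>Rewrite\<close>, which carries the pending rules of the matrix). Absence of the
  forbidding word needs a full pass from the left end (\<open>ScanF\<close>), each move of which reads ahead
  as many symbols as that word has. Erasing the markers early is harmless: it only disables the
  passes.\<close>

datatype 't state = Start | LeftEnd | RightEnd | Sym nat | CheckP "'t matrix" | CheckF "'t matrix" | ScanF "'t matrix"
  | Rewrite "(nat \<times> 't sym list) list"

fun emb :: "'t sym \<Rightarrow> 't state + 't" where
  "emb (Tm a) = Inr a"
| "emb (Nt k) = Inl (Sym k)"

lemma emb_inject [simp]: "emb c = emb d \<longleftrightarrow> c = d"
  by (cases c; cases d) auto

lemma inj_emb: "inj emb"
  by (simp add: inj_def)

lemma emb_neq [simp]: "emb c \<noteq> Inl Start" "emb c \<noteq> Inl LeftEnd" "emb c \<noteq> Inl RightEnd" "emb c \<noteq> Inl (CheckP r)"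
  "emb c \<noteq> Inl (CheckF r)" "emb c \<noteq> Inl (ScanF r)" "emb c \<noteq> Inl (Rewrite rs)"
  "Inl Start \<noteq> emb c" "Inl LeftEnd \<noteq> emb c" "Inl RightEnd \<noteq> emb c" "Inl (CheckP r) \<noteq> emb c"
  "Inl (CheckF r) \<noteq> emb c" "Inl (ScanF r) \<noteq> emb c" "Inl (Rewrite rs) \<noteq> emb c"
  by (cases c; simp)+

abbreviation "embs \<equiv> map emb"

definition pword :: "'t matrix \<Rightarrow> 't sym list" where
  "pword r = (case pcond r of None \<Rightarrow> [] | Some P \<Rightarrow> P)"

text \<open>Embedded symbols differ from \<open>RightEnd\<close>, so what the head reads cannot
  extend into the right marker.\<close>

lemma embs_split:
  assumes "embs v @ q = embs x @ rm" "set rm \<subseteq> {Inl RightEnd}"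
  shows "\<exists>x'. x = v @ x' \<and> q = embs x' @ rm"
  using assms(1)
proof (induction v arbitrary: x)
  case (Cons c v)
  show ?case
  proof (cases x)
    case Nil
    thus ?thesis using Cons.prems assms(2) by (cases rm) auto
  next
    case (Cons d x')
    thus ?thesis using Cons.prems Cons.IH[of x'] by auto
  qed
qed auto

lemma embs_split_RightEnd:
  assumes "embs v @ Inl RightEnd # q = embs x @ rm" "set rm \<subseteq> {Inl RightEnd}"
  shows "x = v"
proof -
  from embs_split[OF assms] obtain x' where x': "x = v @ x'" "Inl RightEnd # q = embs x' @ rm" by blast
  thus ?thesis by (cases x') auto
qed

lemma left_split:
  assumes "p @ [emb c] = lm @ embs x" "set lm \<subseteq> {Inl LeftEnd}"
  shows "\<exists>x'. x = x' @ [c] \<and> p = lm @ embs x'"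
proof (cases x rule: rev_cases)
  case Nil
  hence "emb c \<in> set lm" using assms(1) by (metis append_Nil2 in_set_conv_decomp list.simps(8))
  thus ?thesis using assms(2) by auto
next
  case (snoc x' d)
  thus ?thesis using assms(1) by auto
qed

lemma left_split_LeftEnd:
  assumes "p @ [Inl LeftEnd] = lm @ embs x"
  shows "x = []"
  using assms by (cases x rule: rev_cases) auto

context
  fixes G :: "'t scm"
  assumes wf: "scm_wf G"
begin

abbreviation "V \<equiv> symbols (nts G) (tms G)"

text \<open>Pending rules of a partly executed matrix. \<open>Rewrite []\<close> is also the idle
  head from which the next matrix is chosen, even if there is none.\<close>

definition tails :: "(nat \<times> 't sym list) list set" where
  "tails = insert [] (\<Union>r \<in> mats G. {rs. suffix rs (rules r)})"

text \<open>The freely moving heads. \<open>ScanF\<close> is left out, since it must not pass an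
  occurrence of the forbidden word.\<close>

definition heads :: "'t state set" where
  "heads = CheckP ` mats G \<union> CheckF ` mats G \<union> Rewrite ` tails"

definition move_prods :: "(('t state + 't) list \<times> ('t state + 't) list) set" where
  "move_prods = (\<lambda>(h, c). ([Inl h, emb c], [emb c, Inl h])) ` (heads \<times> V) \<union>
     (\<lambda>(h, c). ([emb c, Inl h], [Inl h, emb c])) ` (heads \<times> V)"

text \<open>Each move certifies that no occurrence of \<open>F\<close> starts at the symbol passed;
  fewer than \<open>length F\<close> symbols before \<open>RightEnd\<close> leave no room for
  another one.\<close>

definition scan_prods :: "'t matrix \<Rightarrow> (('t state + 't) list \<times> ('t state + 't) list) set" where
  "scan_prods r = (case fcond r of
      None \<Rightarrow> {([Inl (CheckF r)], [Inl (Rewrite (rules r))])}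
    | Some F \<Rightarrow> {([Inl LeftEnd, Inl (CheckF r)], [Inl LeftEnd, Inl (ScanF r)])} \<union>
        (\<lambda>v. (Inl (ScanF r) # embs v, emb (hd v) # Inl (ScanF r) # embs (tl v))) `
          {v. set v \<subseteq> V \<and> length v = length F \<and> v \<noteq> F} \<union>
        (\<lambda>v. (Inl (ScanF r) # embs v @ [Inl RightEnd], Inl (Rewrite (rules r)) # embs v @ [Inl RightEnd])) `
          {v. set v \<subseteq> V \<and> length v < length F})"

definition sim_prods :: "(('t state + 't) list \<times> ('t state + 't) list) set" where
  "sim_prods =
     {([Inl Start], [Inl LeftEnd, Inl (Rewrite []), Inl (Sym (start G)), Inl RightEnd]),
      ([Inl LeftEnd], []), ([Inl RightEnd], []), ([Inl (Rewrite [])], [])} \<union>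
     move_prods \<union>
     (\<lambda>r. ([Inl (Rewrite [])], [Inl (CheckP r)])) ` mats G \<union>
     (\<lambda>r. (Inl (CheckP r) # embs (pword r), Inl (CheckF r) # embs (pword r))) ` mats G \<union>
     (\<Union>r \<in> mats G. scan_prods r) \<union>
     (\<lambda>rs. ([Inl (Rewrite rs), Inl (Sym (fst (hd rs)))], Inl (Rewrite (tl rs)) # embs (snd (hd rs)))) ` (tails - {[]})"

lemma sim_prodsE:
  assumes "(\<alpha>, \<beta>) \<in> sim_prods"
  obtains (start) "\<alpha> = [Inl Start]" "\<beta> = [Inl LeftEnd, Inl (Rewrite []), Inl (Sym (start G)), Inl RightEnd]"
  | (LeftEnd) "\<alpha> = [Inl LeftEnd]" "\<beta> = []"
  | (RightEnd) "\<alpha> = [Inl RightEnd]" "\<beta> = []"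
  | (stop) "\<alpha> = [Inl (Rewrite [])]" "\<beta> = []"
  | (right) h c where "h \<in> heads" "c \<in> V" "\<alpha> = [Inl h, emb c]" "\<beta> = [emb c, Inl h]"
  | (left) h c where "h \<in> heads" "c \<in> V" "\<alpha> = [emb c, Inl h]" "\<beta> = [Inl h, emb c]"
  | (choose) r where "r \<in> mats G" "\<alpha> = [Inl (Rewrite [])]" "\<beta> = [Inl (CheckP r)]"
  | (check) r where "r \<in> mats G" "\<alpha> = Inl (CheckP r) # embs (pword r)" "\<beta> = Inl (CheckF r) # embs (pword r)"
  | (noscan) r where "r \<in> mats G" "fcond r = None" "\<alpha> = [Inl (CheckF r)]" "\<beta> = [Inl (Rewrite (rules r))]"
  | (scan_start) r F where "r \<in> mats G" "fcond r = Some F" "\<alpha> = [Inl LeftEnd, Inl (CheckF r)]"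
      "\<beta> = [Inl LeftEnd, Inl (ScanF r)]"
  | (scan) r F v where "r \<in> mats G" "fcond r = Some F" "set v \<subseteq> V" "length v = length F" "v \<noteq> F"
      "\<alpha> = Inl (ScanF r) # embs v" "\<beta> = emb (hd v) # Inl (ScanF r) # embs (tl v)"
  | (scan_end) r F v where "r \<in> mats G" "fcond r = Some F" "set v \<subseteq> V" "length v < length F"
      "\<alpha> = Inl (ScanF r) # embs v @ [Inl RightEnd]" "\<beta> = Inl (Rewrite (rules r)) # embs v @ [Inl RightEnd]"
  | (rewrite) A x rs where "(A, x) # rs \<in> tails" "\<alpha> = [Inl (Rewrite ((A, x) # rs)), Inl (Sym A)]"
      "\<beta> = Inl (Rewrite rs) # embs x"
proof -
  from assms consider
      "(\<alpha>, \<beta>) = ([Inl Start], [Inl LeftEnd, Inl (Rewrite []), Inl (Sym (scm.start G)), Inl RightEnd])"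
    | "(\<alpha>, \<beta>) = ([Inl LeftEnd], [])" | "(\<alpha>, \<beta>) = ([Inl RightEnd], [])" | "(\<alpha>, \<beta>) = ([Inl (Rewrite [])], [])"
    | "(\<alpha>, \<beta>) \<in> move_prods"
    | "(\<alpha>, \<beta>) \<in> (\<lambda>r. ([Inl (Rewrite [])], [Inl (CheckP r)])) ` mats G"
    | "(\<alpha>, \<beta>) \<in> (\<lambda>r. (Inl (CheckP r) # embs (pword r), Inl (CheckF r) # embs (pword r))) ` mats G"
    | r where "r \<in> mats G" "(\<alpha>, \<beta>) \<in> scan_prods r"
    | "(\<alpha>, \<beta>) \<in> (\<lambda>rs. ([Inl (Rewrite rs), Inl (Sym (fst (hd rs)))], Inl (Rewrite (tl rs)) # embs (snd (hd rs)))) ` (tails - {[]})"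
    unfolding sim_prods_def by blast
  thus thesis
  proof cases
    case 1 thus ?thesis using start by blast
  next
    case 2 thus ?thesis using LeftEnd by blast
  next
    case 3 thus ?thesis using RightEnd by blast
  next
    case 4 thus ?thesis using stop by blast
  next
    case 5
    then consider h c where "h \<in> heads" "c \<in> V" "(\<alpha>, \<beta>) = ([Inl h, emb c], [emb c, Inl h])"
      | h c where "h \<in> heads" "c \<in> V" "(\<alpha>, \<beta>) = ([emb c, Inl h], [Inl h, emb c])"
      unfolding move_prods_def by auto
    thus ?thesis using right left by cases blast+
  next
    case 6 thus ?thesis using choose by blast
  next
    case 7 thus ?thesis using check by blast
  next
    case (8 r)
    thus ?thesis
    proof (cases "fcond r")
      case None
      thus ?thesis using 8 noscan by (simp add: scan_prods_def)
    next
      case (Some F)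
      from 8(2) Some consider "(\<alpha>, \<beta>) = ([Inl LeftEnd, Inl (CheckF r)], [Inl LeftEnd, Inl (ScanF r)])"
        | v where "set v \<subseteq> V" "length v = length F" "v \<noteq> F"
          "(\<alpha>, \<beta>) = (Inl (ScanF r) # embs v, emb (hd v) # Inl (ScanF r) # embs (tl v))"
        | v where "set v \<subseteq> V" "length v < length F"
          "(\<alpha>, \<beta>) = (Inl (ScanF r) # embs v @ [Inl RightEnd], Inl (Rewrite (rules r)) # embs v @ [Inl RightEnd])"
        unfolding scan_prods_def by auto
      thus ?thesis
      proof cases
        case 1 thus ?thesis using scan_start[OF 8(1) Some] by blast
      next
        case 2 thus ?thesis using scan[OF 8(1) Some] by blast
      next
        case 3 thus ?thesis using scan_end[OF 8(1) Some] by blast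
      qed
    qed
  next
    case 9
    then obtain rs where "rs \<in> tails" "rs \<noteq> []"
      "\<alpha> = [Inl (Rewrite rs), Inl (Sym (fst (hd rs)))]" "\<beta> = Inl (Rewrite (tl rs)) # embs (snd (hd rs))" by blast
    thus ?thesis using rewrite[of "fst (hd rs)" "snd (hd rs)" "tl rs"] by (cases rs) auto
  qed
qed

section \<open>Soundness of the simulation\<close>

abbreviation der :: "'t sym list \<Rightarrow> bool" where
  "der x \<equiv> (scm_step G)\<^sup>*\<^sup>* [Nt (start G)] x"

text \<open>While a matrix is being executed, the word to which it was applied is lost; the clause
  for \<open>Rewrite\<close> therefore speaks of all outcomes of the pending rules.
  \<open>ScanF\<close> records that no occurrence of \<open>F\<close> starts to the left of the
  head.\<close>

fun head_inv :: "'t state \<Rightarrow> 't sym list \<Rightarrow> 't sym list \<Rightarrow> bool" where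
  "head_inv (CheckP r) x y \<longleftrightarrow> r \<in> mats G \<and> der (x @ y)"
| "head_inv (CheckF r) x y \<longleftrightarrow> r \<in> mats G \<and> der (x @ y) \<and> sublist (pword r) (x @ y)"
| "head_inv (ScanF r) x y \<longleftrightarrow> r \<in> mats G \<and> der (x @ y) \<and> sublist (pword r) (x @ y) \<and>
     (\<exists>F. fcond r = Some F \<and> (\<forall>p q. x @ y = p @ F @ q \<longrightarrow> length x \<le> length p))"
| "head_inv (Rewrite rs) x y \<longleftrightarrow> (\<forall>z. rewrite_seq rs (x @ y) z \<longrightarrow> der z)"
| "head_inv _ x y \<longleftrightarrow> False"

text \<open>\<open>lm\<close> and \<open>rm\<close> are arbitrary lists of markers, so that erasing
  a marker preserves the form.\<close>

definition headed :: "('t state + 't) list \<Rightarrow> bool" where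
  "headed s \<longleftrightarrow> (\<exists>lm rm x y h. s = (lm @ embs x) @ Inl h # embs y @ rm \<and> set lm \<subseteq> {Inl LeftEnd} \<and>
     set rm \<subseteq> {Inl RightEnd} \<and> head_inv h x y)"

definition headless :: "('t state + 't) list \<Rightarrow> bool" where
  "headless s \<longleftrightarrow> (\<exists>lm rm x. s = lm @ embs x @ rm \<and> set lm \<subseteq> {Inl LeftEnd} \<and> set rm \<subseteq> {Inl RightEnd} \<and> der x)"

lemma headedI:
  "s = (lm @ embs x) @ Inl h # embs y @ rm \<Longrightarrow> set lm \<subseteq> {Inl LeftEnd} \<Longrightarrow> set rm \<subseteq> {Inl RightEnd} \<Longrightarrow> head_inv h x y
   \<Longrightarrow> headed s"
  unfolding headed_def by blast

lemma head_split:
  assumes e: "a @ Inl h # b = p @ Inl h' # q" and "Inl h' \<notin> set a" "Inl h' \<notin> set b"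
  shows "h' = h \<and> p = a \<and> q = b"
proof -
  have "Inl h' \<in> set (a @ Inl h # b)" unfolding e by simp
  hence "h' = h" using assms(2,3) by auto
  thus ?thesis using e assms(2,3) append_Cons_eq_iff[of "Inl h" a b p q] by auto
qed

lemma erase_left:
  assumes "p @ c # q = lm @ t" "c \<notin> set t"
  shows "\<exists>q'. lm = p @ c # q' \<and> q = q' @ t"
proof -
  from assms(1) consider us where "p = lm @ us" "us @ c # q = t" | us where "p @ us = lm" "c # q = us @ t"
    unfolding append_eq_append_conv2 by blast
  thus ?thesis
  proof cases
    case 1 thus ?thesis using assms(2) by auto
  next
    case 2 thus ?thesis using assms(2) by (cases us) auto
  qed
qed

lemma erase_right:
  assumes "p @ c # q = t @ rm" "c \<notin> set t"
  shows "\<exists>p'. rm = p' @ c # q \<and> p = t @ p'"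
proof -
  from assms(1) consider us where "p = t @ us" "us @ c # q = rm" | us where "p @ us = t" "c # q = us @ rm"
    unfolding append_eq_append_conv2 by blast
  thus ?thesis
  proof cases
    case 1 thus ?thesis by auto
  next
    case 2 thus ?thesis using assms(2) by (cases us) auto
  qed
qed

lemma apply_matrix:
  assumes "r \<in> mats G" "der x" "sublist (pword r) x" "\<And>F. fcond r = Some F \<Longrightarrow> \<not> sublist F x"
    "rewrite_seq (rules r) x z"
  shows "der z"
proof -
  have "mstep r x z" unfolding mstep_def using assms
    by (auto simp: pword_def split: option.splits)
  hence "scm_step G x z" using assms(1) unfolding scm_step_def by blast
  thus ?thesis using assms(2) by simp
qed

lemma headed_step:
  assumes s: "headed s" and st: "rstep sim_prods s t"
  shows "headed t \<or> headless t"
proof -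
  from s obtain lm rm x y h where s: "s = (lm @ embs x) @ Inl h # embs y @ rm"
    and lm: "set lm \<subseteq> {Inl LeftEnd}" and rm: "set rm \<subseteq> {Inl RightEnd}" and h: "head_inv h x y"
    unfolding headed_def by blast
  have h_neq: "h \<noteq> Start" "h \<noteq> LeftEnd" "h \<noteq> RightEnd" using h by auto
  from st obtain \<alpha> \<beta> p q where ab: "(\<alpha>, \<beta>) \<in> sim_prods" and s': "s = p @ \<alpha> @ q" and t: "t = p @ \<beta> @ q"
    by (rule rstepE)
  \<comment> \<open>There is only one head, so a production that contains a head matches exactly
    there.\<close>
  have split: "h' = h \<and> p' = lm @ embs x \<and> q' = embs y @ rm"
    if "s = p' @ Inl h' # q'" "\<And>c. emb c \<noteq> Inl h'" "h' \<noteq> LeftEnd" "h' \<noteq> RightEnd" for p' h' q'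
    using that(1) unfolding s
    by (rule head_split) (use that(2-) lm rm in \<open>force dest: sym\<close>)+
  from ab show ?thesis
  proof (cases rule: sim_prodsE)
    case start
    thus ?thesis using split[of p Start q] s' h_neq by simp
  next
    case LeftEnd
    have e: "p @ Inl LeftEnd # q = lm @ embs x @ Inl h # embs y @ rm" using s s' LeftEnd by simp
    have n: "Inl LeftEnd \<notin> set (embs x @ Inl h # embs y @ rm)" using h_neq rm by auto
    from erase_left[OF e n] obtain q' where "lm = p @ Inl LeftEnd # q'" "q = q' @ embs x @ Inl h # embs y @ rm" by blast
    thus ?thesis using lm rm h LeftEnd t by (intro disjI1 headedI[of _ "p @ q'" x h y rm]) auto
  next
    case RightEnd
    have e: "p @ Inl RightEnd # q = ((lm @ embs x) @ Inl h # embs y) @ rm" using s s' RightEnd by simp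
    have n: "Inl RightEnd \<notin> set ((lm @ embs x) @ Inl h # embs y)" using h_neq lm by auto
    from erase_right[OF e n] obtain p' where "rm = p' @ Inl RightEnd # q" "p = ((lm @ embs x) @ Inl h # embs y) @ p'" by blast
    thus ?thesis using lm rm h RightEnd t by (intro disjI1 headedI[of _ lm x h y "p' @ q"]) auto
  next
    case stop
    hence "h = Rewrite [] \<and> p = lm @ embs x \<and> q = embs y @ rm" using split[of p "Rewrite []" q] s' by auto
    thus ?thesis using h lm rm t stop unfolding headless_def
      by (intro disjI2 exI[of _ lm] exI[of _ rm] exI[of _ "x @ y"]) auto
  next
    case (right h' c)
    have "h' = h \<and> p = lm @ embs x \<and> emb c # q = embs y @ rm"
      using split[of p h' "emb c # q"] s' right by (auto simp: heads_def)
    moreover from this obtain y' where "y = c # y'" "q = embs y' @ rm"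
      using embs_split[of "[c]" q y rm] rm by auto
    ultimately show ?thesis using h lm rm t right
      by (intro disjI1 headedI[of _ lm "x @ [c]" h y' rm]) (auto simp: heads_def)
  next
    case (left h' c)
    have *: "h' = h \<and> p @ [emb c] = lm @ embs x \<and> q = embs y @ rm"
      using split[of "p @ [emb c]" h' q] s' left by (auto simp: heads_def)
    moreover from this obtain x' where "x = x' @ [c]" "p = lm @ embs x'"
      using left_split lm by blast
    ultimately show ?thesis using h lm rm t left
      by (intro disjI1 headedI[of _ lm x' h "c # y" rm]) (auto simp: heads_def)
  next
    case (choose r)
    hence "h = Rewrite [] \<and> p = lm @ embs x \<and> q = embs y @ rm" using split[of p "Rewrite []" q] s' by auto
    thus ?thesis using h lm rm t choose
      by (intro disjI1 headedI[of _ lm x "CheckP r" y rm]) auto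
  next
    case (check r)
    hence *: "h = CheckP r \<and> p = lm @ embs x \<and> embs (pword r) @ q = embs y @ rm"
      using split[of p "CheckP r" "embs (pword r) @ q"] s' by auto
    then obtain y' where "y = pword r @ y'" using embs_split rm by blast
    hence "sublist (pword r) (x @ y)" by simp
    thus ?thesis using * h lm rm t check
      by (intro disjI1 headedI[of _ lm x "CheckF r" y rm]) auto
  next
    case (noscan r)
    hence *: "h = CheckF r \<and> p = lm @ embs x \<and> q = embs y @ rm" using split[of p "CheckF r" q] s' by auto
    hence "head_inv (Rewrite (rules r)) x y" using h noscan(2) by (auto intro: apply_matrix)
    thus ?thesis using * lm rm t noscan by (intro disjI1 headedI[of _ lm x "Rewrite (rules r)" y rm]) auto
  next
    case (scan_start r F)
    have *: "h = CheckF r \<and> p @ [Inl LeftEnd] = lm @ embs x \<and> q = embs y @ rm"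
      using split[of "p @ [Inl LeftEnd]" "CheckF r" q] s' scan_start by auto
    hence "x = []" using left_split_LeftEnd by blast
    thus ?thesis using * h lm rm t scan_start
      by (intro disjI1 headedI[of _ lm x "ScanF r" y rm]) auto
  next
    case (scan r F v)
    have *: "h = ScanF r \<and> p = lm @ embs x \<and> embs v @ q = embs y @ rm"
      using split[of p "ScanF r" "embs v @ q"] s' scan by auto
    then obtain y' where y: "y = v @ y'" "q = embs y' @ rm" using embs_split rm by blast
    have "F \<noteq> []" using wf scan(1,2) unfolding scm_wf_def matrix_ok_def cond_ok_def by fastforce
    then obtain c v' where v: "v = c # v'" using scan(4) by (cases v) auto
    \<comment> \<open>An occurrence starting exactly at the head would make the window
      \<open>v\<close> equal to \<open>F\<close>.\<close>
    have "Suc (length x) \<le> length a" if "x @ y = a @ F @ b" for a b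
    proof (rule ccontr)
      assume "\<not> Suc (length x) \<le> length a"
      moreover have "length x \<le> length a" using h * scan(2) that by auto
      ultimately have "length a = length x" by simp
      hence "F @ b = v @ y'" using that y(1) by simp
      thus False using scan(4,5) by simp
    qed
    hence "head_inv (ScanF r) (x @ [c]) (v' @ y')" using h * scan(2) y(1) v by auto
    thus ?thesis using * lm rm t scan y v
      by (intro disjI1 headedI[of _ lm "x @ [c]" "ScanF r" "v' @ y'" rm]) auto
  next
    case (scan_end r F v)
    have *: "h = ScanF r \<and> p = lm @ embs x \<and> embs v @ Inl RightEnd # q = embs y @ rm"
      using split[of p "ScanF r" "embs v @ Inl RightEnd # q"] s' scan_end by auto
    hence y: "y = v" using embs_split_RightEnd rm by blast
    \<comment> \<open>An occurrence can neither start before the head nor fit behind it.\<close>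
    have "\<not> sublist F (x @ y)"
    proof
      assume "sublist F (x @ y)"
      then obtain a b where ab: "x @ y = a @ F @ b" by (auto simp: sublist_def)
      hence "length x \<le> length a" using h * scan_end(2) by auto
      thus False using arg_cong[OF ab, of length] scan_end(4) y by simp
    qed
    hence "head_inv (Rewrite (rules r)) x y" using h * scan_end(2) by (auto intro: apply_matrix)
    thus ?thesis using * lm rm t scan_end y
      by (intro disjI1 headedI[of _ lm x "Rewrite (rules r)" y rm]) auto
  next
    case (rewrite A u rs)
    have *: "h = Rewrite ((A, u) # rs) \<and> p = lm @ embs x \<and> Inl (Sym A) # q = embs y @ rm"
      using split[of p "Rewrite ((A, u) # rs)" "Inl (Sym A) # q"] s' rewrite by auto
    then obtain y' where y: "y = Nt A # y'" "q = embs y' @ rm"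
      using embs_split[of "[Nt A]" q y rm] rm by auto
    have "rewrite1 A u (x @ y) (x @ u @ y')" unfolding rewrite1_def y by auto
    hence "head_inv (Rewrite rs) x (u @ y')" using h * by auto
    thus ?thesis using * lm rm t rewrite y
      by (intro disjI1 headedI[of _ lm x "Rewrite rs" "u @ y'" rm]) auto
  qed
qed

lemma headless_step:
  assumes s: "headless s" and st: "rstep sim_prods s t"
  shows "headless t"
proof -
  from s obtain lm rm x where s: "s = lm @ embs x @ rm"
    and lm: "set lm \<subseteq> {Inl LeftEnd}" and rm: "set rm \<subseteq> {Inl RightEnd}" and x: "der x"
    unfolding headless_def by blast
  from st obtain \<alpha> \<beta> p q where ab: "(\<alpha>, \<beta>) \<in> sim_prods" and s': "s = p @ \<alpha> @ q" and t: "t = p @ \<beta> @ q"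
    by (rule rstepE)
  have no: "Inl h \<notin> set \<alpha>" if "\<And>c. emb c \<noteq> Inl h" "h \<noteq> LeftEnd" "h \<noteq> RightEnd" for h
  proof -
    have "Inl h \<notin> set s" unfolding s using lm rm that by (force dest: sym)
    thus ?thesis unfolding s' by simp
  qed
  from ab show ?thesis
  proof (cases rule: sim_prodsE)
    case LeftEnd
    have e: "p @ Inl LeftEnd # q = lm @ embs x @ rm" using s s' LeftEnd by simp
    have n: "Inl LeftEnd \<notin> set (embs x @ rm)" using rm by auto
    from erase_left[OF e n] obtain q' where "lm = p @ Inl LeftEnd # q'" "q = q' @ embs x @ rm" by blast
    thus ?thesis using lm rm x LeftEnd t unfolding headless_def
      by (intro exI[of _ "p @ q'"] exI[of _ rm] exI[of _ x]) auto
  next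
    case RightEnd
    have e: "p @ Inl RightEnd # q = (lm @ embs x) @ rm" using s s' RightEnd by simp
    have n: "Inl RightEnd \<notin> set (lm @ embs x)" using lm by auto
    from erase_right[OF e n] obtain p' where "rm = p' @ Inl RightEnd # q" "p = (lm @ embs x) @ p'" by blast
    thus ?thesis using lm rm x RightEnd t unfolding headless_def
      by (intro exI[of _ lm] exI[of _ "p' @ q"] exI[of _ x]) auto
  next
    case start
    thus ?thesis using no[of Start] by simp
  next
    case stop
    thus ?thesis using no[of "Rewrite []"] by simp
  next
    case (right h c)
    thus ?thesis using no[of h] by (auto simp: heads_def)
  next
    case (left h c)
    thus ?thesis using no[of h] by (auto simp: heads_def)
  next
    case (choose r)
    thus ?thesis using no[of "Rewrite []"] by simp
  next
    case (check r)
    thus ?thesis using no[of "CheckP r"] by simp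
  next
    case (noscan r)
    thus ?thesis using no[of "CheckF r"] by simp
  next
    case (scan_start r F)
    thus ?thesis using no[of "CheckF r"] by simp
  next
    case (scan r F v)
    thus ?thesis using no[of "ScanF r"] by simp
  next
    case (scan_end r F v)
    thus ?thesis using no[of "ScanF r"] by simp
  next
    case (rewrite A u rs)
    thus ?thesis using no[of "Rewrite ((A, u) # rs)"] by simp
  qed
qed

lemma start_step:
  assumes "rstep sim_prods [Inl Start] t"
  shows "headed t"
proof -
  from assms obtain \<alpha> \<beta> p q where ab: "(\<alpha>, \<beta>) \<in> sim_prods" and s': "[Inl Start] = p @ \<alpha> @ q"
    and t: "t = p @ \<beta> @ q" by (rule rstepE)
  from s' have "set \<alpha> \<subseteq> {Inl Start}" by (metis append.assoc empty_set list.simps(15) set_append sup_ge1 sup_ge2 order_trans)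
  with ab have *: "\<alpha> = [Inl Start] \<and> \<beta> = [Inl LeftEnd, Inl (Rewrite []), Inl (Sym (start G)), Inl RightEnd]"
    by (cases rule: sim_prodsE) (auto simp: heads_def)
  hence "p = [] \<and> q = []" using s' by (cases p) auto
  thus ?thesis using t * by (intro headedI[of _ "[Inl LeftEnd]" "[]" "Rewrite []" "[Nt (start G)]" "[Inl RightEnd]"]) auto
qed

lemma sim_sound:
  assumes "(rstep sim_prods)\<^sup>*\<^sup>* [Inl Start] (map Inr w)"
  shows "der (map Tm w)"
proof -
  have "t = [Inl Start] \<or> headed t \<or> headless t" if "(rstep sim_prods)\<^sup>*\<^sup>* [Inl Start] t" for t
    using that
    by (induction rule: rtranclp_induct) (use headed_step headless_step start_step in blast)+
  moreover have "map Inr w \<noteq> ([Inl Start] :: ('t state + 't) list)" by (cases w) auto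
  ultimately have "headed (map Inr w) \<or> headless (map Inr w)" using assms by blast
  moreover have "\<not> headed (map Inr w)"
  proof
    assume "headed (map Inr w)"
    then obtain h where "Inl h \<in> set (map Inr w :: ('t state + 't) list)" unfolding headed_def by force
    thus False by auto
  qed
  ultimately have "headless (map Inr w)" by auto
  then obtain lm rm x where w: "map Inr w = lm @ embs x @ rm"
    and lm: "set lm \<subseteq> {Inl LeftEnd}" and rm: "set rm \<subseteq> {Inl RightEnd}" and x: "der x"
    unfolding headless_def by blast
  have "Inl LeftEnd \<notin> set lm" "Inl RightEnd \<notin> set rm" using arg_cong[OF w, of set] by auto
  hence "lm = []" "rm = []" using lm rm by (cases lm; cases rm; auto)+
  hence "embs (map Tm w) = embs x" using w by (simp add: comp_def)
  thus ?thesis using x inj_emb by (metis map_injective)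
qed

section \<open>Completeness of the simulation\<close>

abbreviation sim :: "('t state + 't) list \<Rightarrow> ('t state + 't) list \<Rightarrow> bool" where
  "sim \<equiv> (rstep sim_prods)\<^sup>*\<^sup>*"

lemma sim_prod: "(\<alpha>, \<beta>) \<in> sim_prods \<Longrightarrow> sim (p @ \<alpha> @ q) (p @ \<beta> @ q)"
  using rstepI by blast

lemma sim_left:
  assumes h: "h \<in> heads" and u: "set u \<subseteq> V"
  shows "sim (p @ embs u @ Inl h # q) (p @ Inl h # embs u @ q)"
  using u
proof (induction u arbitrary: q rule: rev_induct)
  case (snoc c u)
  have "([emb c, Inl h], [Inl h, emb c]) \<in> sim_prods"
    using h snoc(2) unfolding sim_prods_def move_prods_def by force
  from sim_prod[OF this, of "p @ embs u" q] snoc.IH[of "emb c # q"] snoc(2) show ?case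
    by (simp add: rtranclp_trans)
qed simp

lemma sim_right:
  assumes h: "h \<in> heads" and u: "set u \<subseteq> V"
  shows "sim (p @ Inl h # embs u @ q) (p @ embs u @ Inl h # q)"
  using u
proof (induction u arbitrary: p)
  case (Cons c u)
  have "([Inl h, emb c], [emb c, Inl h]) \<in> sim_prods"
    using h Cons(2) unfolding sim_prods_def move_prods_def by force
  from sim_prod[OF this, of p "embs u @ q"] Cons.IH[of "p @ [emb c]"] Cons(2) show ?case
    by (simp add: rtranclp_trans)
qed simp

definition conf :: "'t sym list \<Rightarrow> 't state \<Rightarrow> 't sym list \<Rightarrow> ('t state + 't) list" where
  "conf x h y = (Inl LeftEnd # embs x) @ Inl h # embs y @ [Inl RightEnd]"

lemma conf_left:
  assumes "h \<in> heads" "set x \<subseteq> V"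
  shows "sim (conf x h y) (conf [] h (x @ y))"
  using sim_left[OF assms, of "[Inl LeftEnd]" "embs y @ [Inl RightEnd]"] by (simp add: conf_def)

lemma conf_right:
  assumes "h \<in> heads" "set x \<subseteq> V"
  shows "sim (conf [] h (x @ y)) (conf x h y)"
  using sim_right[OF assms, of "[Inl LeftEnd]" "embs y @ [Inl RightEnd]"] by (simp add: conf_def)

lemma conf_step:
  assumes "(Inl h # embs u, Inl h' # embs v) \<in> sim_prods"
  shows "sim (conf x h (u @ y)) (conf x h' (v @ y))"
  using sim_prod[OF assms, of "Inl LeftEnd # embs x" "embs y @ [Inl RightEnd]"] by (simp add: conf_def)

lemma tails_ConsD: "(A, x) # rs \<in> tails \<Longrightarrow> rs \<in> tails"
  unfolding tails_def using suffix_ConsD by fastforce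

lemma tails_ok: "(A, x) # rs \<in> tails \<Longrightarrow> set x \<subseteq> V \<and> A \<in> nts G"
proof -
  assume "(A, x) # rs \<in> tails"
  then obtain r where r: "r \<in> mats G" "suffix ((A, x) # rs) (rules r)" unfolding tails_def by auto
  hence "(A, x) \<in> set (rules r)" using set_mono_suffix by fastforce
  thus ?thesis using wf r(1) unfolding scm_wf_def matrix_ok_def by fastforce
qed

text \<open>After each rule the head returns to the left end, so every stage starts and ends in a
  configuration \<open>conf []\<close>.\<close>

lemma sim_rewrite_seq:
  assumes "rewrite_seq rs x y" "rs \<in> tails" "set x \<subseteq> V"
  shows "sim (conf [] (Rewrite rs) x) (conf [] (Rewrite []) y) \<and> set y \<subseteq> V"
  using assms
proof (induction rs arbitrary: x)
  case (Cons Au rs)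
  obtain A u where Au: "Au = (A, u)" by (cases Au)
  from Cons.prems(1) obtain p q where x: "x = p @ Nt A # q" and y: "rewrite_seq rs (p @ u @ q) y"
    unfolding Au by (auto simp: rewrite1_def)
  have t: "rs \<in> tails" using Cons.prems(2) tails_ConsD unfolding Au by blast
  have u: "set u \<subseteq> V" using Cons.prems(2) tails_ok unfolding Au by blast
  have h: "Rewrite (Au # rs) \<in> heads" "Rewrite rs \<in> heads" using Cons.prems(2) t by (auto simp: heads_def)
  have p: "set p \<subseteq> V" "set q \<subseteq> V" using Cons.prems(3) x by auto
  have "(Inl (Rewrite (Au # rs)) # embs [Nt A], Inl (Rewrite rs) # embs u) \<in> sim_prods"
    using Cons.prems(2) unfolding sim_prods_def Au by force
  from conf_step[OF this, of p q] have "sim (conf p (Rewrite (Au # rs)) (Nt A # q)) (conf p (Rewrite rs) (u @ q))"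
    by simp
  with conf_right[OF h(1) p(1), of "Nt A # q"] conf_left[OF h(2) p(1), of "u @ q"]
  have "sim (conf [] (Rewrite (Au # rs)) x) (conf [] (Rewrite rs) (p @ u @ q))"
    unfolding x by (meson rtranclp_trans)
  moreover have "sim (conf [] (Rewrite rs) (p @ u @ q)) (conf [] (Rewrite []) y) \<and> set y \<subseteq> V"
    by (rule Cons.IH[OF y t]) (use p u in auto)
  ultimately show ?case by (meson rtranclp_trans)
qed simp

lemma sim_scan:
  assumes r: "r \<in> mats G" and F: "fcond r = Some F" and no: "\<not> sublist F (x @ y)"
    and V: "set x \<subseteq> V" "set y \<subseteq> V"
  shows "sim (conf x (ScanF r) y) (conf [] (Rewrite (rules r)) (x @ y))"
  using no V
proof (induction y arbitrary: x)
  have F0: "F \<noteq> []" using wf r F unfolding scm_wf_def matrix_ok_def cond_ok_def by fastforce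
  have fin: "sim (conf x (ScanF r) y) (conf [] (Rewrite (rules r)) (x @ y))"
    if "length y < length F" "set x \<subseteq> V" "set y \<subseteq> V" for x y
  proof -
    have "(Inl (ScanF r) # embs y @ [Inl RightEnd], Inl (Rewrite (rules r)) # embs y @ [Inl RightEnd]) \<in> scan_prods r"
      using that F by (auto simp: scan_prods_def)
    hence "(Inl (ScanF r) # embs y @ [Inl RightEnd], Inl (Rewrite (rules r)) # embs y @ [Inl RightEnd]) \<in> sim_prods"
      using r unfolding sim_prods_def by blast
    from sim_prod[OF this, of "Inl LeftEnd # embs x" "[]"]
    have "sim (conf x (ScanF r) y) (conf x (Rewrite (rules r)) y)" by (simp add: conf_def)
    moreover have "Rewrite (rules r) \<in> heads" using r by (auto simp: heads_def tails_def)
    ultimately show ?thesis using conf_left that(2) by (meson rtranclp_trans)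
  qed
  {
    case Nil
    thus ?case using fin[of "[]" x] F0 by simp
  next
    case (Cons c y)
    show ?case
    proof (cases "length (c # y) < length F")
      case True
      thus ?thesis using fin Cons.prems by blast
    next
      case False
      define v where "v = take (length F) (c # y)"
      obtain v' where v': "v = c # v'" using F0 unfolding v_def by (cases F) auto
      have y: "y = v' @ drop (length F) (c # y)"
        using append_take_drop_id[of "length F" "c # y"] v' unfolding v_def by simp
      have "length v = length F" using False by (simp add: v_def)
      moreover have "v \<noteq> F"
      proof
        assume "v = F"
        hence "c # y = F @ drop (length F) (c # y)" unfolding v_def by (metis append_take_drop_id)
        thus False using Cons.prems(1) by (metis sublist_appendI)
      qed
      moreover have "set v \<subseteq> V" using Cons.prems(3) set_take_subset[of "length F" "c # y"]
        unfolding v_def by blast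
      ultimately have "(Inl (ScanF r) # embs v, emb (hd v) # Inl (ScanF r) # embs (tl v)) \<in> scan_prods r"
        using F by (auto simp: scan_prods_def)
      hence "(Inl (ScanF r) # emb c # embs v', emb c # Inl (ScanF r) # embs v') \<in> sim_prods"
        using r v' unfolding sim_prods_def by auto
      from sim_prod[OF this, of "Inl LeftEnd # embs x" "embs (drop (length F) (c # y)) @ [Inl RightEnd]"]
      have "sim (conf x (ScanF r) (c # v' @ drop (length F) (c # y)))
        (conf (x @ [c]) (ScanF r) (v' @ drop (length F) (c # y)))"
        unfolding conf_def by simp
      hence "sim (conf x (ScanF r) (c # y)) (conf (x @ [c]) (ScanF r) y)" unfolding y[symmetric] .
      moreover have "sim (conf (x @ [c]) (ScanF r) y) (conf [] (Rewrite (rules r)) ((x @ [c]) @ y))"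
        by (rule Cons.IH) (use Cons.prems in auto)
      ultimately show ?thesis by simp
    qed
  }
qed

lemma sim_matrix:
  assumes r: "r \<in> mats G" and m: "mstep r x y" and x: "set x \<subseteq> V"
  shows "sim (conf [] (Rewrite []) x) (conf [] (Rewrite []) y) \<and> set y \<subseteq> V"
proof -
  have h: "CheckP r \<in> heads" "CheckF r \<in> heads" using r by (auto simp: heads_def)
  have "([Inl (Rewrite [])], [Inl (CheckP r)]) \<in> sim_prods" using r unfolding sim_prods_def by blast
  with conf_step[of "Rewrite []" "[]" "CheckP r" "[]" "[]" x]
  have 1: "sim (conf [] (Rewrite []) x) (conf [] (CheckP r) x)" by simp
  have "sublist (pword r) x" using m by (auto simp: mstep_def pword_def split: option.splits)
  then obtain p q where pq: "x = p @ pword r @ q" by (auto simp: sublist_def)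
  have p: "set p \<subseteq> V" using x pq by auto
  have "(Inl (CheckP r) # embs (pword r), Inl (CheckF r) # embs (pword r)) \<in> sim_prods"
    using r unfolding sim_prods_def by blast
  from conf_step[OF this, of p q] conf_right[OF h(1) p] conf_left[OF h(2) p]
  have 2: "sim (conf [] (CheckP r) x) (conf [] (CheckF r) x)"
    unfolding pq by (meson rtranclp_trans)
  have 3: "sim (conf [] (CheckF r) x) (conf [] (Rewrite (rules r)) x)"
  proof (cases "fcond r")
    case None
    hence "([Inl (CheckF r)], [Inl (Rewrite (rules r))]) \<in> scan_prods r" by (simp add: scan_prods_def)
    hence "([Inl (CheckF r)], [Inl (Rewrite (rules r))]) \<in> sim_prods" using r unfolding sim_prods_def by blast
    with conf_step[of "CheckF r" "[]" "Rewrite (rules r)" "[]" "[]" x] show ?thesis by simp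
  next
    case (Some F)
    hence "([Inl LeftEnd, Inl (CheckF r)], [Inl LeftEnd, Inl (ScanF r)]) \<in> scan_prods r" by (simp add: scan_prods_def)
    hence "([Inl LeftEnd, Inl (CheckF r)], [Inl LeftEnd, Inl (ScanF r)]) \<in> sim_prods"
      using r unfolding sim_prods_def by blast
    from sim_prod[OF this, of "[]" "embs x @ [Inl RightEnd]"]
    have "sim (conf [] (CheckF r) x) (conf [] (ScanF r) x)" by (simp add: conf_def)
    moreover have "\<not> sublist F ([] @ x)" using m Some by (simp add: mstep_def)
    ultimately show ?thesis using sim_scan[OF r Some, of "[]" x] x by simp
  qed
  have "rules r \<in> tails" using r by (auto simp: tails_def)
  moreover have "rewrite_seq (rules r) x y" using m by (simp add: mstep_def)
  ultimately have "sim (conf [] (Rewrite (rules r)) x) (conf [] (Rewrite []) y) \<and> set y \<subseteq> V"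
    using sim_rewrite_seq x by blast
  thus ?thesis using 1 2 3 by (meson rtranclp_trans)
qed

lemma sim_complete:
  assumes "der x"
  shows "sim [Inl Start] (conf [] (Rewrite []) x) \<and> set x \<subseteq> V"
  using assms
proof (induction rule: rtranclp_induct)
  case base
  have "([Inl Start], [Inl LeftEnd, Inl (Rewrite []), Inl (Sym (start G)), Inl RightEnd]) \<in> sim_prods"
    unfolding sim_prods_def by blast
  from sim_prod[OF this, of "[]" "[]"] wf show ?case by (auto simp: conf_def scm_wf_def symbols_def)
next
  case (step x y)
  thus ?case using sim_matrix unfolding scm_step_def by (meson rtranclp_trans)
qed

lemma sim_erase: "sim (conf [] (Rewrite []) x) (embs x)"
proof -
  have p: "([Inl LeftEnd], []) \<in> sim_prods" "([Inl RightEnd], []) \<in> sim_prods" "([Inl (Rewrite [])], []) \<in> sim_prods"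
    unfolding sim_prods_def by blast+
  have "sim (conf [] (Rewrite []) x) (Inl (Rewrite []) # embs x @ [Inl RightEnd])"
    using sim_prod[OF p(1), of "[]" "Inl (Rewrite []) # embs x @ [Inl RightEnd]"] by (simp add: conf_def)
  also have "sim \<dots> (embs x @ [Inl RightEnd])" using sim_prod[OF p(3), of "[]" "embs x @ [Inl RightEnd]"] by simp
  also have "sim \<dots> (embs x)" using sim_prod[OF p(2), of "embs x" "[]"] by simp
  finally show ?thesis .
qed

lemma sim_iff: "sim [Inl Start] (map Inr w) \<longleftrightarrow> der (map Tm w)"
proof
  assume "der (map Tm w)"
  with sim_complete sim_erase[of "map Tm w"] have "sim [Inl Start] (embs (map Tm w))"
    by (meson rtranclp_trans)
  thus "sim [Inl Start] (map Inr w)" by (simp add: comp_def)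
qed (rule sim_sound)

section \<open>Finiteness of the simulating grammar\<close>

lemma finite_V: "finite V"
  using wf by (simp add: scm_wf_def symbols_def)

lemma finite_sim_prods: "finite sim_prods"
proof -
  have fm: "finite (mats G)" using wf by (simp add: scm_wf_def)
  have "finite {rs. suffix rs (rules r)}" for r :: "'t matrix"
    using finite_set[of "suffixes (rules r)"] by (simp add: set_suffixes_eq)
  hence ft: "finite tails" using fm by (simp add: tails_def)
  hence "finite heads" using fm by (simp add: heads_def)
  hence "finite move_prods" using finite_V by (simp add: move_prods_def)
  moreover have "finite (scan_prods r)" for r
  proof -
    have "finite {v. set v \<subseteq> V \<and> length v = n \<and> v \<noteq> F}" for n F
      by (rule finite_subset[OF _ finite_lists_length_eq[OF finite_V, of n]]) auto
    moreover have "finite {v. set v \<subseteq> V \<and> length v < n}" for n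
      by (rule finite_subset[OF _ finite_lists_length_le[OF finite_V, of n]]) auto
    ultimately show ?thesis by (auto simp: scan_prods_def split: option.splits)
  qed
  ultimately show ?thesis using fm ft by (simp add: sim_prods_def)
qed

lemma scm_lang_RE: "scm_lang G \<in> RE"
proof -
  \<comment> \<open>The type of states is infinite; apart from \<open>Start\<close>, only those
    occurring in productions are taken as nonterminals.\<close>
  define N where "N = insert Start (\<Union>(\<alpha>, \<beta>) \<in> sim_prods. Inl -` (set \<alpha> \<union> set \<beta>))"
  have finN: "finite N" unfolding N_def using finite_sim_prods by (auto intro!: finite_vimageI)
  have *: "Inr a \<notin> set \<alpha> \<union> set \<beta>" if "(\<alpha>, \<beta>) \<in> sim_prods" "a \<notin> tms G" for \<alpha> \<beta> a
  proof -
    have e: "emb c \<noteq> Inr a" if "c \<in> V" for c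
      using that \<open>a \<notin> tms G\<close> by (cases c) (auto simp: symbols_def)
    have no_Inr: "Inr a \<notin> set (embs v)" if "set v \<subseteq> V" for v using that e by force
    have P: "set (pword r) \<subseteq> V" if "r \<in> mats G" for r
    proof -
      have "cond_ok V (pcond r)" using wf that unfolding scm_wf_def matrix_ok_def by blast
      thus ?thesis by (auto simp: cond_ok_def pword_def split: option.splits)
    qed
    from that(1) show ?thesis
    proof (cases rule: sim_prodsE)
      case (right h c)
      thus ?thesis using e[of c] by auto
    next
      case (left h c)
      thus ?thesis using e[of c] by auto
    next
      case (check r)
      thus ?thesis using no_Inr[OF P] by auto
    next
      case (scan r F v)
      \<comment> \<open>Makes \<open>v\<close> nonempty, so that \<open>hd v\<close> is a symbol of
        \<open>v\<close> and not an unspecified value.\<close>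
      have "F \<noteq> []" using wf scan(1,2) unfolding scm_wf_def matrix_ok_def cond_ok_def by fastforce
      thus ?thesis using scan no_Inr[of v] by (cases v) auto
    next
      case (scan_end r F v)
      thus ?thesis using no_Inr[of v] by auto
    next
      case (rewrite A x rs)
      thus ?thesis using no_Inr[of x] tails_ok by auto
    qed auto
  qed
  have ok: "set \<alpha> \<subseteq> N <+> tms G \<and> set \<beta> \<subseteq> N <+> tms G \<and> (\<exists>n. Inl n \<in> set \<alpha>)"
    if "(\<alpha>, \<beta>) \<in> sim_prods" for \<alpha> \<beta>
  proof -
    have "c \<in> N <+> tms G" if "c \<in> set \<alpha> \<union> set \<beta>" for c
    proof (cases c)
      case (Inl n)
      hence "n \<in> N" using that \<open>(\<alpha>, \<beta>) \<in> sim_prods\<close> unfolding N_def by force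
      thus ?thesis by (simp add: Inl InlI)
    next
      case (Inr a)
      thus ?thesis using * that \<open>(\<alpha>, \<beta>) \<in> sim_prods\<close> by blast
    qed
    moreover have "\<exists>n. Inl n \<in> set \<alpha>" using that by (cases rule: sim_prodsE) auto
    ultimately show ?thesis by blast
  qed
  have "finite (tms G)" "Start \<in> N" using wf by (auto simp: scm_wf_def N_def)
  hence "{w. set w \<subseteq> tms G \<and> sim [Inl Start] (map Inr w)} \<in> RE"
    using RE_rename[OF finite_sim_prods _ finN _ ok] by blast
  thus ?thesis unfolding sim_iff scm_lang_def .
qed

end

lemma SCM_subset_RE: "SCM i j n m l s \<subseteq> RE"
  unfolding SCM_def using scm_lang_RE by blast

theorem mainTheorem4:
  shows "(SCM 4 3 4 7 2 6 :: 't list set set) = RE"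
  using SCM_subset_RE RE_subset_SCM by blast

end
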